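(* Let $R$ be a 2-primal strongly 2-nil-clean ring. Then the matrix ring $M_n(R)$ is trinil clean for all $n\in\mathbb{N}$.
   Context: All rings are associative with identity, not necessarily commutative. $\mathbb{N}$ is the set of positive integers and $M_n(R)$ is the ring of $n\times n$ matrices over $R$. An element $e$ of a ring is a tripotent if $e^3=e$. A ring is trinil clean if every element is the sum of a tripotent and a nilpotent (no commutation required). A ring is strongly 2-nil-clean if every element is the sum of two idempotents and a nilpotent that commute with one another. A ring is 2-primal if its prime radical (the intersection of all prime ideals) coincides with the set of all its nilpotent elements. *)

theory Defs
  imports "HOL-Algebra.Ideal_Product" "Jordan_Normal_Form.Matrix"
begin

text \<open>
  Rings are HOL-Algebra rings: the locale \<^locale>\<open>ring\<close> is associative with identity, not
  necessarily commutative, and admits the zero ring.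
\<close>

definition idempotent_elem :: "('a, 'm) ring_scheme \<Rightarrow> 'a \<Rightarrow> bool" where
  "idempotent_elem R e \<longleftrightarrow> e \<in> carrier R \<and> e \<otimes>\<^bsub>R\<^esub> e = e"

definition tripotent_elem :: "('a, 'm) ring_scheme \<Rightarrow> 'a \<Rightarrow> bool" where
  "tripotent_elem R e \<longleftrightarrow> e \<in> carrier R \<and> e [^]\<^bsub>R\<^esub> (3::nat) = e"

definition nilpotent_elem :: "('a, 'm) ring_scheme \<Rightarrow> 'a \<Rightarrow> bool" where
  "nilpotent_elem R b \<longleftrightarrow> b \<in> carrier R \<and> (\<exists>k::nat. k > 0 \<and> b [^]\<^bsub>R\<^esub> k = \<zero>\<^bsub>R\<^esub>)"

definition trinil_clean :: "('a, 'm) ring_scheme \<Rightarrow> bool" where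
  "trinil_clean R \<longleftrightarrow>
     (\<forall>a\<in>carrier R. \<exists>e b. tripotent_elem R e \<and> nilpotent_elem R b \<and> a = e \<oplus>\<^bsub>R\<^esub> b)"

definition strongly_2_nil_clean :: "('a, 'm) ring_scheme \<Rightarrow> bool" where
  "strongly_2_nil_clean R \<longleftrightarrow>
     (\<forall>a\<in>carrier R. \<exists>e f b.
        idempotent_elem R e \<and> idempotent_elem R f \<and> nilpotent_elem R b \<and>
        e \<otimes>\<^bsub>R\<^esub> f = f \<otimes>\<^bsub>R\<^esub> e \<and> e \<otimes>\<^bsub>R\<^esub> b = b \<otimes>\<^bsub>R\<^esub> e \<and> f \<otimes>\<^bsub>R\<^esub> b = b \<otimes>\<^bsub>R\<^esub> f \<and>
        a = e \<oplus>\<^bsub>R\<^esub> f \<oplus>\<^bsub>R\<^esub> b)"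

text \<open>
  The library's \<^locale>\<open>primeideal\<close> is restricted to commutative rings and is elementwise
  (completely prime). Over a noncommutative ring a prime ideal is a proper two-sided ideal that is
  prime with respect to products of two-sided ideals.
\<close>

definition nc_prime_ideal :: "'a set \<Rightarrow> ('a, 'm) ring_scheme \<Rightarrow> bool" where
  "nc_prime_ideal P R \<longleftrightarrow>
     ideal P R \<and> P \<noteq> carrier R \<and>
     (\<forall>I J. ideal I R \<longrightarrow> ideal J R \<longrightarrow> ideal_prod R I J \<subseteq> P \<longrightarrow> I \<subseteq> P \<or> J \<subseteq> P)"

text \<open>
  The intersection is taken inside the carrier, so that it equals \<^term>\<open>carrier R\<close> when
  there are no prime ideals (the zero ring).
\<close>

definition prime_radical :: "('a, 'm) ring_scheme \<Rightarrow> 'a set" where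
  "prime_radical R = {a \<in> carrier R. \<forall>P. nc_prime_ideal P R \<longrightarrow> a \<in> P}"

definition two_primal :: "('a, 'm) ring_scheme \<Rightarrow> bool" where
  "two_primal R \<longleftrightarrow> prime_radical R = {a. nilpotent_elem R a}"

text \<open>
  The library's matrix operations work over type classes, so only its type of matrices is used
  here, with the operations of the record \<^term>\<open>R\<close> on the entries.
\<close>

definition matrix_ring :: "nat \<Rightarrow> ('a, 'm) ring_scheme \<Rightarrow> 'a mat ring" where
  "matrix_ring n R =
     \<lparr> carrier = {A \<in> carrier_mat n n. \<forall>i<n. \<forall>j<n. A $$ (i, j) \<in> carrier R},
       monoid.mult = (\<lambda>A B. mat n n (\<lambda>(i, j). \<Oplus>\<^bsub>R\<^esub>k\<in>{..<n}. A $$ (i, k) \<otimes>\<^bsub>R\<^esub> B $$ (k, j))),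
       one = mat n n (\<lambda>(i, j). if i = j then \<one>\<^bsub>R\<^esub> else \<zero>\<^bsub>R\<^esub>),
       zero = mat n n (\<lambda>(i, j). \<zero>\<^bsub>R\<^esub>),
       add = (\<lambda>A B. mat n n (\<lambda>(i, j). A $$ (i, j) \<oplus>\<^bsub>R\<^esub> B $$ (i, j))) \<rparr>"

context ring
begin

lemma finsum_swap:
  assumes "finite A" "finite B" "\<And>i j. i \<in> A \<Longrightarrow> j \<in> B \<Longrightarrow> f i j \<in> carrier R"
  shows "(\<Oplus>i\<in>A. \<Oplus>j\<in>B. f i j) = (\<Oplus>j\<in>B. \<Oplus>i\<in>A. f i j)"
  using assms(1,3)
proof (induction A rule: finite_induct)
  case empty
  then show ?case by (simp add: finsum_zero)
next
  case (insert x F)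
  have c: "\<And>j. j \<in> B \<Longrightarrow> (\<Oplus>i\<in>F. f i j) \<in> carrier R"
    using insert.prems by (intro finsum_closed) auto
  have "(\<Oplus>i\<in>insert x F. \<Oplus>j\<in>B. f i j) = (\<Oplus>j\<in>B. f x j) \<oplus> (\<Oplus>i\<in>F. \<Oplus>j\<in>B. f i j)"
    using insert by (intro finsum_insert) (auto intro!: finsum_closed)
  also have "\<dots> = (\<Oplus>j\<in>B. f x j) \<oplus> (\<Oplus>j\<in>B. \<Oplus>i\<in>F. f i j)"
    using insert by simp
  also have "\<dots> = (\<Oplus>j\<in>B. f x j \<oplus> (\<Oplus>i\<in>F. f i j))"
    using insert.prems c by (intro finsum_addf[symmetric]) auto
  also have "\<dots> = (\<Oplus>j\<in>B. \<Oplus>i\<in>insert x F. f i j)"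
    using insert by (intro finsum_cong') (auto intro!: finsum_closed finsum_insert[symmetric])
  finally show ?case .
qed

lemma finsum_delta:
  assumes "finite A" "i \<in> A" "\<And>k. k \<in> A \<Longrightarrow> f k \<in> carrier R"
  shows "(\<Oplus>k\<in>A. if i = k then f k else \<zero>) = f i"
  using add.finprod_singleton[of i A f] assms by (auto simp: Pi_def)

lemma ring_matrix_ring: "ring (matrix_ring n R)"
proof (rule ringI)
  let ?M = "matrix_ring n R"
  show "abelian_group ?M"
  proof (rule abelian_groupI)
    fix A assume A: "A \<in> carrier ?M"
    show "\<exists>B\<in>carrier ?M. B \<oplus>\<^bsub>?M\<^esub> A = \<zero>\<^bsub>?M\<^esub>"
      using A by (intro bexI[of _ "mat n n (\<lambda>(i, j). \<ominus> (A $$ (i, j)))"])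
        (auto simp: matrix_ring_def l_neg intro!: eq_matI)
  qed (auto simp: matrix_ring_def a_ac intro!: eq_matI)
  show "monoid ?M"
  proof (rule monoidI)
    fix A B C assume A: "A \<in> carrier ?M" and B: "B \<in> carrier ?M" and C: "C \<in> carrier ?M"
    show "A \<otimes>\<^bsub>?M\<^esub> B \<otimes>\<^bsub>?M\<^esub> C = A \<otimes>\<^bsub>?M\<^esub> (B \<otimes>\<^bsub>?M\<^esub> C)"
    proof (rule eq_matI, goal_cases)
      case (1 i j)
      then have ij: "i < n" "j < n" by (auto simp: matrix_ring_def)
      have c: "\<And>i j. i < n \<Longrightarrow> j < n \<Longrightarrow> A $$ (i, j) \<in> carrier R"
              "\<And>i j. i < n \<Longrightarrow> j < n \<Longrightarrow> B $$ (i, j) \<in> carrier R"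
              "\<And>i j. i < n \<Longrightarrow> j < n \<Longrightarrow> C $$ (i, j) \<in> carrier R"
        using A B C by (auto simp: matrix_ring_def)
      have "(\<Oplus>k\<in>{..<n}. (\<Oplus>l\<in>{..<n}. A $$ (i, l) \<otimes> B $$ (l, k)) \<otimes> C $$ (k, j))
          = (\<Oplus>k\<in>{..<n}. \<Oplus>l\<in>{..<n}. A $$ (i, l) \<otimes> B $$ (l, k) \<otimes> C $$ (k, j))"
        using c ij by (intro finsum_cong') (auto intro!: finsum_closed finsum_ldistr)
      also have "\<dots> = (\<Oplus>l\<in>{..<n}. \<Oplus>k\<in>{..<n}. A $$ (i, l) \<otimes> B $$ (l, k) \<otimes> C $$ (k, j))"
        using c ij by (intro finsum_swap) auto
      also have "\<dots> = (\<Oplus>l\<in>{..<n}. \<Oplus>k\<in>{..<n}. A $$ (i, l) \<otimes> (B $$ (l, k) \<otimes> C $$ (k, j)))"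
        using c ij by (intro finsum_cong') (auto intro!: finsum_closed finsum_cong' m_assoc)
      also have "\<dots> = (\<Oplus>l\<in>{..<n}. A $$ (i, l) \<otimes> (\<Oplus>k\<in>{..<n}. B $$ (l, k) \<otimes> C $$ (k, j)))"
        using c ij by (intro finsum_cong') (auto intro!: finsum_closed finsum_rdistr[symmetric])
      finally have "(\<Oplus>k\<in>{..<n}. (\<Oplus>l\<in>{..<n}. A $$ (i, l) \<otimes> B $$ (l, k)) \<otimes> C $$ (k, j))
        = (\<Oplus>l\<in>{..<n}. A $$ (i, l) \<otimes> (\<Oplus>k\<in>{..<n}. B $$ (l, k) \<otimes> C $$ (k, j)))" .
      moreover have "(A \<otimes>\<^bsub>?M\<^esub> B \<otimes>\<^bsub>?M\<^esub> C) $$ (i, j)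
        = (\<Oplus>k\<in>{..<n}. (\<Oplus>l\<in>{..<n}. A $$ (i, l) \<otimes> B $$ (l, k)) \<otimes> C $$ (k, j))"
        using ij c by (auto simp: matrix_ring_def intro!: finsum_cong' finsum_closed)
      moreover have "(A \<otimes>\<^bsub>?M\<^esub> (B \<otimes>\<^bsub>?M\<^esub> C)) $$ (i, j)
        = (\<Oplus>l\<in>{..<n}. A $$ (i, l) \<otimes> (\<Oplus>k\<in>{..<n}. B $$ (l, k) \<otimes> C $$ (k, j)))"
        using ij c by (auto simp: matrix_ring_def intro!: finsum_cong' finsum_closed)
      ultimately show ?case by simp
    qed (auto simp: matrix_ring_def)
  next
    fix A assume A: "A \<in> carrier ?M"
    then have c: "\<And>i j. i < n \<Longrightarrow> j < n \<Longrightarrow> A $$ (i, j) \<in> carrier R"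
      and d: "dim_row A = n" "dim_col A = n" by (auto simp: matrix_ring_def)
    show "\<one>\<^bsub>?M\<^esub> \<otimes>\<^bsub>?M\<^esub> A = A"
    proof (rule eq_matI, goal_cases)
      case (1 i j)
      then have ij: "i < n" "j < n" using d by auto
      have "(\<one>\<^bsub>?M\<^esub> \<otimes>\<^bsub>?M\<^esub> A) $$ (i, j) = (\<Oplus>k\<in>{..<n}. if i = k then A $$ (k, j) else \<zero>)"
        using ij c by (auto simp: matrix_ring_def intro!: finsum_cong')
      also have "\<dots> = A $$ (i, j)" using ij c by (intro finsum_delta) auto
      finally show ?case .
    qed (auto simp: matrix_ring_def d)
    show "A \<otimes>\<^bsub>?M\<^esub> \<one>\<^bsub>?M\<^esub> = A"
    proof (rule eq_matI, goal_cases)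
      case (1 i j)
      then have ij: "i < n" "j < n" using d by auto
      have "(A \<otimes>\<^bsub>?M\<^esub> \<one>\<^bsub>?M\<^esub>) $$ (i, j) = (\<Oplus>k\<in>{..<n}. if j = k then A $$ (i, k) else \<zero>)"
        using ij c by (auto simp: matrix_ring_def intro!: finsum_cong')
      also have "\<dots> = A $$ (i, j)" using ij c by (intro finsum_delta) auto
      finally show ?case .
    qed (auto simp: matrix_ring_def d)
  qed (auto simp: matrix_ring_def intro!: finsum_closed)
next
  let ?M = "matrix_ring n R"
  fix A B C assume A: "A \<in> carrier ?M" and B: "B \<in> carrier ?M" and C: "C \<in> carrier ?M"
  have c: "\<And>i j. i < n \<Longrightarrow> j < n \<Longrightarrow> A $$ (i, j) \<in> carrier R"
          "\<And>i j. i < n \<Longrightarrow> j < n \<Longrightarrow> B $$ (i, j) \<in> carrier R"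
          "\<And>i j. i < n \<Longrightarrow> j < n \<Longrightarrow> C $$ (i, j) \<in> carrier R"
    using A B C by (auto simp: matrix_ring_def)
  have l: "(\<Oplus>k\<in>{..<n}. (A $$ (i, k) \<oplus> B $$ (i, k)) \<otimes> C $$ (k, j))
     = (\<Oplus>k\<in>{..<n}. A $$ (i, k) \<otimes> C $$ (k, j)) \<oplus> (\<Oplus>k\<in>{..<n}. B $$ (i, k) \<otimes> C $$ (k, j))"
    if "i < n" "j < n" for i j
  proof -
    have "(\<Oplus>k\<in>{..<n}. (A $$ (i, k) \<oplus> B $$ (i, k)) \<otimes> C $$ (k, j))
       = (\<Oplus>k\<in>{..<n}. A $$ (i, k) \<otimes> C $$ (k, j) \<oplus> B $$ (i, k) \<otimes> C $$ (k, j))"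
      using that c by (intro finsum_cong') (auto simp: l_distr)
    then show ?thesis using that c by (simp add: finsum_addf)
  qed
  have r: "(\<Oplus>k\<in>{..<n}. C $$ (i, k) \<otimes> (A $$ (k, j) \<oplus> B $$ (k, j)))
     = (\<Oplus>k\<in>{..<n}. C $$ (i, k) \<otimes> A $$ (k, j)) \<oplus> (\<Oplus>k\<in>{..<n}. C $$ (i, k) \<otimes> B $$ (k, j))"
    if "i < n" "j < n" for i j
  proof -
    have "(\<Oplus>k\<in>{..<n}. C $$ (i, k) \<otimes> (A $$ (k, j) \<oplus> B $$ (k, j)))
       = (\<Oplus>k\<in>{..<n}. C $$ (i, k) \<otimes> A $$ (k, j) \<oplus> C $$ (i, k) \<otimes> B $$ (k, j))"
      using that c by (intro finsum_cong') (auto simp: r_distr)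
    then show ?thesis using that c by (simp add: finsum_addf)
  qed
  show "(A \<oplus>\<^bsub>?M\<^esub> B) \<otimes>\<^bsub>?M\<^esub> C = A \<otimes>\<^bsub>?M\<^esub> C \<oplus>\<^bsub>?M\<^esub> B \<otimes>\<^bsub>?M\<^esub> C"
  proof (rule eq_matI, goal_cases)
    case (1 i j)
    then have ij: "i < n" "j < n" by (auto simp: matrix_ring_def)
    have "((A \<oplus>\<^bsub>?M\<^esub> B) \<otimes>\<^bsub>?M\<^esub> C) $$ (i, j)
       = (\<Oplus>k\<in>{..<n}. (A $$ (i, k) \<oplus> B $$ (i, k)) \<otimes> C $$ (k, j))"
      using ij c by (auto simp: matrix_ring_def intro!: finsum_cong')
    then show ?case using ij l by (simp add: matrix_ring_def)
  qed (auto simp: matrix_ring_def)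
  show "C \<otimes>\<^bsub>?M\<^esub> (A \<oplus>\<^bsub>?M\<^esub> B) = C \<otimes>\<^bsub>?M\<^esub> A \<oplus>\<^bsub>?M\<^esub> C \<otimes>\<^bsub>?M\<^esub> B"
  proof (rule eq_matI, goal_cases)
    case (1 i j)
    then have ij: "i < n" "j < n" by (auto simp: matrix_ring_def)
    have "(C \<otimes>\<^bsub>?M\<^esub> (A \<oplus>\<^bsub>?M\<^esub> B)) $$ (i, j)
       = (\<Oplus>k\<in>{..<n}. C $$ (i, k) \<otimes> (A $$ (k, j) \<oplus> B $$ (k, j)))"
      using ij c by (auto simp: matrix_ring_def intro!: finsum_cong')
    then show ?case using ij r by (simp add: matrix_ring_def)
  qed (auto simp: matrix_ring_def)
qed

end

end

theory Submission
  imports Defs "HOL-Library.Function_Algebras" "HOL-Algebra.QuotRing"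
    "HOL-Algebra.Ring_Divisibility" "HOL-Algebra.UnivPoly"
begin

text \<open>
  Let \<open>N\<close> be the set of nilpotent elements, which is the prime radical, and \<open>S = R / N\<close>. Writing
  \<open>a = e + f + b\<close> with commuting summands shows \<open>6 = 0\<close> and \<open>x\<^sup>3 = x\<close> in \<open>S\<close>
  (\<open>strongly_2_nil_clean_quotient_tripotent\<close>). Hence idempotents of \<open>S\<close> are central, and finitely many
  elements of \<open>S\<close> become constant, with values in the prime field of characteristic 2 or 3, on the pieces
  of a finite decomposition of \<open>1\<close> into orthogonal idempotents (\<open>idempotent_split_induct\<close>). Applied to
  the entries of a matrix, this reduces matrices over \<open>S\<close> to matrices over \<open>GF(2)\<close> and \<open>GF(3)\<close>.

  Over a field, a Krylov basis of a cyclic piece can be shifted by scalars \<open>d\<^sub>0, d\<^sub>1, \<dots>\<close> so that the operator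
  becomes the shift along the basis, which is nilpotent, plus an upper triangular operator with diagonal
  \<open>d\<^sub>0, d\<^sub>1, \<dots>\<close>. The trace fixes only the sum of the \<open>d\<^sub>j\<close>, and they can usually be chosen so that the
  triangular part is diagonalizable; the exceptions over \<open>GF(2)\<close> are treated by hand. Pieces are stacked along
  a flag of invariant subspaces, so no normal form is required (\<open>diag_plus_nil_on_span\<close>). Over \<open>GF(2)\<close> and
  \<open>GF(3)\<close> a diagonalizable operator is a difference of two orthogonal idempotents.

  Matrices over \<open>N\<close> are nilpotent: otherwise an ideal that is maximal among those containing the entries of
  no power of the matrix would be prime, hence contain \<open>N\<close> and with it the entries of the matrix itself
  (\<open>matrix_over_prime_radical_nilpotent\<close>). Therefore decompositions \<open>g - q + w\<close> with orthogonal idempotents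
  \<open>g\<close>, \<open>q\<close> and nilpotent \<open>w\<close> lift from matrices over \<open>S\<close> to matrices over \<open>R\<close>
  (\<open>signed_nil_clean_elem_lifts\<close>), and \<open>g - q\<close> is tripotent.
\<close>

section \<open>Linear operators as a diagonalizable plus a nilpotent operator\<close>

text \<open>
  The last summand is the eigenvalue that must be separated from the others. Taking the others to be
  \<open>0\<close>, except for one that absorbs the rest of the sum, leaves the condition that the last summand \<open>c\<close>
  satisfies \<open>c \<noteq> 0\<close> and \<open>2 c \<noteq> t\<close>, which \<open>1\<close> or \<open>-1\<close> fulfils.
\<close>

lemma trace_as_separated_sum:
  fixes t :: "'k::field" and m :: nat
  assumes "(2::'k) \<noteq> 0" and "m > 0"
  shows "\<exists>d. (\<Sum>i<m. d i) = t \<and> (\<forall>j<m - 1. d j \<noteq> d (m - 1))"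
proof (cases "m = 1")
  case True
  then show ?thesis by (intro exI[of _ "\<lambda>_. t"]) simp
next
  case False
  then obtain n where m: "m = Suc (Suc n)" using assms(2) by (metis One_nat_def not0_implies_Suc not_gr0)
  define c :: 'k where "c = (if t = 2 then - 1 else 1)"
  have "(4::'k) = 2 * 2" by simp
  then have "(4::'k) \<noteq> 0" using assms(1) by (simp only: mult_eq_0_iff) simp
  then have "c \<noteq> 0" "t \<noteq> c + c" by (auto simp: c_def eq_neg_iff_add_eq_0)
  then have c: "c \<noteq> 0" "t - c \<noteq> c" by (auto simp: diff_eq_eq)
  define d where "d j = (if j = Suc n then c else if j = 0 then t - c else 0)" for j
  have "(\<Sum>i<m. d i) = (\<Sum>i<Suc n. d i) + d (Suc n)" by (simp add: m)
  also have "(\<Sum>i<Suc n. d i) = d 0 + (\<Sum>i<n. d (Suc i))" by (rule sum.lessThan_Suc_shift)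
  also have "(\<Sum>i<n. d (Suc i)) = 0" by (intro sum.neutral) (auto simp: d_def)
  finally have "(\<Sum>i<m. d i) = t" by (simp add: d_def)
  moreover have "\<forall>j<m - 1. d j \<noteq> d (m - 1)" using c by (auto simp: d_def m)
  ultimately show ?thesis by blast
qed

locale linear_operator = vector_space scale
  for scale :: "'k::field \<Rightarrow> 'v::ab_group_add \<Rightarrow> 'v" (infixr \<open>*s\<close> 75) +
  fixes T :: "'v \<Rightarrow> 'v"
  assumes T: "Vector_Spaces.linear scale scale T"
begin

interpretation endo: vector_space_pair scale scale ..

abbreviation lin :: "('v \<Rightarrow> 'v) \<Rightarrow> bool" where
  "lin \<equiv> Vector_Spaces.linear scale scale"

text \<open>
  Diagonalizability is expressed by a spanning set of eigenvectors and not by an identity such as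
  \<open>E\<^sup>3 = E\<close>, because every identity that is needed later follows on eigenvectors from the
  possible eigenvalues, and the construction then does not depend on the field.
\<close>

definition diag_plus_nil_on :: "'v set \<Rightarrow> bool" where
  "diag_plus_nil_on U \<longleftrightarrow> subspace U \<and> T ` U \<subseteq> U \<and>
     (\<exists>E k. lin E \<and> E ` U \<subseteq> U \<and> U \<subseteq> span {x \<in> U. \<exists>c. E x = c *s x} \<and>
        (\<forall>u\<in>U. ((\<lambda>x. T x - E x) ^^ k) u = 0))"

lemma lin_extend_by_vector:
  assumes U: "subspace U" and E: "lin E" and w: "w \<notin> U"
  shows "\<exists>E'. lin E' \<and> (\<forall>u\<in>U. E' u = E u) \<and> E' w = y"
proof -
  obtain B where B: "B \<subseteq> U" "independent B" "U \<subseteq> span B"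
    using maximal_independent_subset by blast
  have sB: "span B = U" using B U by (simp add: span_subspace)
  have ind: "independent (insert w B)" using B w sB by (simp add: independent_insertI)
  define f where "f = (\<lambda>x. if x = w then y else E x)"
  obtain E' where E': "lin E'" "\<forall>x\<in>insert w B. E' x = f x"
    using endo.linear_independent_extend[OF ind, of f] by blast
  have "E' b = E b" if "b \<in> B" for b using E' that B w by (auto simp: f_def)
  then have "E' u = E u" if "u \<in> U" for u
    using endo.linear_eq_on[OF E'(1) E, of u B] that sB by simp
  moreover have "E' w = y" using E' by (simp add: f_def)
  ultimately show ?thesis using E'(1) by blast
qed

lemma lin_extend_by_sequence:
  fixes m :: nat
  assumes "subspace U" and "lin E"
    and "\<And>j. j < m \<Longrightarrow> e j \<notin> span (U \<union> e ` {..<j})"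
  shows "\<exists>E'. lin E' \<and> (\<forall>u\<in>U. E' u = E u) \<and> (\<forall>j<m. E' (e j) = y j)"
  using assms(3)
proof (induction m)
  case 0
  then show ?case using assms(2) by auto
next
  case (Suc m)
  then obtain E1 where E1: "lin E1" "\<forall>u\<in>U. E1 u = E u" "\<forall>j<m. E1 (e j) = y j" by fastforce
  obtain E' where E': "lin E'" "\<forall>u\<in>span (U \<union> e ` {..<m}). E' u = E1 u" "E' (e m) = y m"
    using lin_extend_by_vector[of "span (U \<union> e ` {..<m})" E1 "e m" "y m"] E1 Suc.prems by auto
  have "E' u = E u" if "u \<in> U" for u
    using E'(2) E1(2) that span_base[of u "U \<union> e ` {..<m}"] by simp
  moreover have "E' (e j) = y j" if "j < Suc m" for j
    using E'(2,3) E1(3) that span_base[of "e j" "U \<union> e ` {..<m}"] by (cases "j = m") auto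
  ultimately show ?case using E'(1) by blast
qed

lemma lin_funpow: "lin f \<Longrightarrow> lin (f ^^ k)"
proof (induction k)
  case 0
  then show ?case using module_hom_ident by (simp add: id_def)
next
  case (Suc k)
  then show ?case using Vector_Spaces.linear_compose[of scale scale "f ^^ k" scale f] by (simp add: o_def)
qed

text \<open>
  The inductive step along a flag. On the new basis vectors \<open>e j\<close> the diagonalizable part is prescribed
  by \<open>y j\<close>, and the rest of \<open>T\<close> shifts \<open>e j\<close> to \<open>e (j + 1)\<close> and finally into \<open>U\<close>. So the \<open>m\<close>-th power of
  the rest maps the larger space into \<open>U\<close>, where it is already nilpotent. The vectors \<open>e j\<close> need only be
  a basis modulo \<open>U\<close>, so no invariant complement of \<open>U\<close> has to be found.
\<close>

lemma diag_plus_nil_extend: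
  fixes m :: nat
  assumes U: "diag_plus_nil_on U"
    and fresh: "\<And>j. j < m \<Longrightarrow> e j \<notin> span (U \<union> e ` {..<j})"
    and y: "\<And>j. j < m \<Longrightarrow> y j \<in> span (e ` {..<m})"
    and chain: "\<And>j. Suc j < m \<Longrightarrow> T (e j) - y j = e (Suc j)"
    and last: "m > 0 \<Longrightarrow> T (e (m - 1)) - y (m - 1) \<in> U"
    and eigen: "\<And>E j. lin E \<Longrightarrow> (\<And>i. i < m \<Longrightarrow> E (e i) = y i) \<Longrightarrow> j < m \<Longrightarrow>
      e j \<in> span {x \<in> span (e ` {..<m}). \<exists>c. E x = c *s x}"
  shows "diag_plus_nil_on (span (U \<union> e ` {..<m}))"
proof -
  let ?S = "e ` {..<m}"
  let ?U' = "span (U \<union> ?S)"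
  from U obtain E0 k where sU: "subspace U" and TU: "T ` U \<subseteq> U" and E0: "lin E0" "E0 ` U \<subseteq> U"
    and eU: "U \<subseteq> span {x \<in> U. \<exists>c. E0 x = c *s x}"
    and nU: "\<And>u. u \<in> U \<Longrightarrow> ((\<lambda>x. T x - E0 x) ^^ k) u = 0"
    unfolding diag_plus_nil_on_def by blast
  obtain E where E: "lin E" and EU: "\<And>u. u \<in> U \<Longrightarrow> E u = E0 u"
    and Ee: "\<And>j. j < m \<Longrightarrow> E (e j) = y j"
    using lin_extend_by_sequence[OF sU E0(1) fresh, of m y] by blast
  define W where "W = (\<lambda>x. T x - E x)"
  have W: "lin W" unfolding W_def using T E by (rule endo.linear_compose_sub)
  have UU': "U \<subseteq> ?U'" and SU': "span ?S \<subseteq> ?U'"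
    by (auto intro: span_base span_mono[THEN subsetD])
  have invariant: "L ` ?U' \<subseteq> V" if "lin L" "subspace V" "L ` U \<subseteq> V" "\<And>j. j < m \<Longrightarrow> L (e j) \<in> V" for L V
  proof -
    have "U \<union> ?S \<subseteq> {x. L x \<in> V}" using that by auto
    then have "?U' \<subseteq> {x. L x \<in> V}"
      using endo.linear_subspace_linear_preimage[OF that(1,2)] by (rule span_minimal)
    then show ?thesis by auto
  qed
  have EU': "E ` ?U' \<subseteq> ?U'"
    using E0 EU Ee y UU' SU' by (intro invariant[OF E]) auto
  have WU: "W ` U \<subseteq> U" using TU E0 EU by (auto simp: W_def intro!: subspace_diff[OF sU])
  have We: "W (e j) \<in> ?U'" if "j < m" for j
  proof (cases "Suc j < m")
    case True
    then show ?thesis using chain[OF True] Ee[of j] that by (auto simp: W_def intro: span_base)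
  next
    case False
    then have "j = m - 1" "m > 0" using that by auto
    then show ?thesis using last Ee[of j] UU' by (auto simp: W_def)
  qed
  have TU': "T ` ?U' \<subseteq> ?U'"
  proof (intro invariant[OF T])
    show "T (e j) \<in> ?U'" if "j < m" for j
      using span_add[OF We[OF that], of "E (e j)"] Ee[OF that] y[OF that] SU' by (auto simp: W_def)
  qed (use TU UU' in auto)
  have eU': "?U' \<subseteq> span {x \<in> ?U'. \<exists>c. E x = c *s x}"
  proof (rule span_minimal)
    have "U \<subseteq> span {x \<in> ?U'. \<exists>c. E x = c *s x}"
      using eU EU UU' span_mono[of "{x \<in> U. \<exists>c. E0 x = c *s x}" "{x \<in> ?U'. \<exists>c. E x = c *s x}"]
      by fastforce
    moreover have "e j \<in> span {x \<in> ?U'. \<exists>c. E x = c *s x}" if "j < m" for j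
      using eigen[OF E Ee that] SU'
        span_mono[of "{x \<in> span ?S. \<exists>c. E x = c *s x}" "{x \<in> ?U'. \<exists>c. E x = c *s x}"] by blast
    ultimately show "U \<union> ?S \<subseteq> span {x \<in> ?U'. \<exists>c. E x = c *s x}" by auto
  qed simp
  have powU: "(W ^^ i) u \<in> U" if "u \<in> U" for i u
    using that WU by (induction i) auto
  have down: "(W ^^ Suc i) (e (m - Suc i)) \<in> U" if "i < m" for i
    using that
  proof (induction i)
    case 0
    then show ?case using last Ee[of "m - 1"] by (simp add: W_def)
  next
    case (Suc i)
    have "Suc (m - Suc (Suc i)) = m - Suc i" using Suc.prems by simp
    then have "W (e (m - Suc (Suc i))) = e (m - Suc i)"
      using chain[of "m - Suc (Suc i)"] Ee[of "m - Suc (Suc i)"] Suc.prems by (simp add: W_def)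
    then show ?case using Suc by (simp add: funpow_Suc_right del: funpow.simps)
  qed
  have "(W ^^ m) (e j) \<in> U" if "j < m" for j
  proof -
    have "(W ^^ (m - j)) (e j) \<in> U" using down[of "m - Suc j"] that by (simp add: Suc_diff_Suc)
    moreover have "(W ^^ m) (e j) = (W ^^ j) ((W ^^ (m - j)) (e j))"
      using that by (metis add_diff_inverse_nat comp_apply funpow_add less_imp_not_less)
    ultimately show ?thesis using powU by simp
  qed
  then have mU: "(W ^^ m) ` ?U' \<subseteq> U"
    using powU sU by (intro invariant[OF lin_funpow[OF W]]) auto
  have agree: "(W ^^ i) u = ((\<lambda>x. T x - E0 x) ^^ i) u" if "u \<in> U" for i u
  proof (induction i)
    case (Suc i)
    then show ?case using EU powU[OF that, of i] by (simp add: W_def)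
  qed simp
  have "(W ^^ (k + m)) u = 0" if "u \<in> ?U'" for u
    using mU that nU agree by (auto simp: funpow_add)
  then show ?thesis unfolding diag_plus_nil_on_def
    using TU' E EU' eU' by (auto simp: W_def)
qed

text \<open>
  For \<open>d = 0\<close> these are the Krylov vectors \<open>T\<^sup>j v\<close>. In general they are the values at \<open>v\<close> of the
  Newton polynomials \<open>(T - d\<^sub>j\<^sub>-\<^sub>1) \<dots> (T - d\<^sub>0)\<close>.
\<close>

primrec chain :: "(nat \<Rightarrow> 'k) \<Rightarrow> 'v \<Rightarrow> nat \<Rightarrow> 'v" where
  "chain d v 0 = v"
| "chain d v (Suc j) = T (chain d v j) - d j *s chain d v j"

lemma T_span:
  assumes "A \<subseteq> {x. T x \<in> span B}"
  shows "T ` span A \<subseteq> span B"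
  using span_minimal[OF assms endo.linear_subspace_linear_preimage[OF T subspace_span]] by auto

text \<open>
  The Krylov vectors lie in a finite-dimensional space, so they cannot stay independent modulo \<open>U\<close>.
\<close>

lemma krylov_length_exists:
  assumes "T ` span B \<subseteq> span B" and "finite B" and "v \<in> span B" and "v \<notin> span U"
  obtains m where "m > 0" "(T ^^ m) v \<in> span (U \<union> (\<lambda>i. (T ^^ i) v) ` {..<m})"
    "\<And>j. j < m \<Longrightarrow> (T ^^ j) v \<notin> span (U \<union> (\<lambda>i. (T ^^ i) v) ` {..<j})"
proof -
  define P where "P j = ((\<lambda>i. (T ^^ i) v) ` {..<j})" for j
  have P_Suc: "P (Suc j) = insert ((T ^^ j) v) (P j)" for j by (simp add: P_def lessThan_Suc)
  define good where "good j \<longleftrightarrow> (T ^^ j) v \<in> span (U \<union> P j)" for j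
  have "\<exists>j. good j"
  proof (rule ccontr)
    assume "\<not> (\<exists>j. good j)"
    then have free: "\<not> good j" for j by simp
    have ind: "independent (P j) \<and> finite (P j) \<and> card (P j) = j" for j
    proof (induction j)
      case (Suc j)
      have "(T ^^ j) v \<notin> span (P j)"
        using free[of j] span_mono[of "P j" "U \<union> P j"] unfolding good_def by blast
      moreover from this have "(T ^^ j) v \<notin> P j" using span_base by blast
      ultimately show ?case using Suc independent_insertI by (simp add: P_Suc)
    qed (simp add: P_def independent_empty)
    have TB: "T x \<in> span B" if "x \<in> span B" for x using assms(1) that by blast
    have "(T ^^ j) v \<in> span B" for j
    proof (induction j)
      case (Suc j)
      then show ?case using TB by simp
    qed (simp add: assms(3))
    then have "P j \<subseteq> span B" for j by (auto simp: P_def)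
    then have "Suc (card B) \<le> card B"
      using independent_span_bound[OF assms(2), of "P (Suc (card B))"] ind[of "Suc (card B)"] by simp
    then show False by simp
  qed
  then obtain m where m: "good m" "\<And>j. j < m \<Longrightarrow> \<not> good j"
    using exists_least_iff[of good] by blast
  have "m > 0" using m(1) assms(4) by (cases m) (simp_all add: good_def P_def)
  then show ?thesis using that m by (simp add: good_def P_def)
qed

text \<open>
  Shifting by scalars does not change the spans of the initial segments. The number \<open>t\<close> is the trace of
  the operator that \<open>T\<close> induces on the new piece modulo \<open>U\<close>: replacing the Krylov basis by a shifted
  one subtracts the sum of the shifts from the last diagonal coefficient.
\<close>

lemma krylov_chain:
  assumes TU: "T ` U \<subseteq> U" and B: "T ` span B \<subseteq> span B" "finite B" and v: "v \<in> span B" "v \<notin> span U"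
  obtains m t where "m > 0"
    "\<And>d j. j < m \<Longrightarrow> chain d v j \<notin> span (U \<union> chain d v ` {..<j})"
    "\<And>d. chain d v m - (t - (\<Sum>i<m. d i)) *s chain d v (m - 1)
       \<in> span (U \<union> chain d v ` {..<m - 1})"
proof -
  define p where "p i = (T ^^ i) v" for i
  have Tp: "T (p i) = p (Suc i)" for i by (simp add: p_def)
  define K where "K j = U \<union> p ` {..<j}" for j
  obtain m where m: "m > 0" "p m \<in> span (K m)" "\<And>j. j < m \<Longrightarrow> p j \<notin> span (K j)"
    using krylov_length_exists[OF B v] unfolding p_def K_def by metis
  have K_Suc: "K (Suc j) = insert (p j) (K j)" for j by (auto simp: K_def lessThan_Suc)
  have K_mono: "x \<in> span (K (Suc j))" if "x \<in> span (K j)" for x j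
    using that span_mono[of "K j" "K (Suc j)"] by (auto simp: K_Suc)
  have K_top: "p j \<in> span (K (Suc j))" for j by (simp add: K_Suc span_base)
  have TK: "T x \<in> span (K (Suc j))" if "x \<in> span (K j)" for x j
  proof -
    have "T y \<in> span (K (Suc j))" if "y \<in> K j" for y
    proof (cases "y \<in> U")
      case True
      then show ?thesis using TU by (intro span_base) (auto simp: K_def)
    next
      case False
      then obtain i where "i < j" "y = p i" using \<open>y \<in> K j\<close> by (auto simp: K_def)
      then show ?thesis by (intro span_base) (simp add: K_def Tp)
    qed
    then have "K j \<subseteq> {x. T x \<in> span (K (Suc j))}" by blast
    then show ?thesis using T_span that by blast
  qed
  \<comment> \<open>The two leading Krylov coefficients of a shifted vector; the second one carries the trace.\<close>
  have second: "chain d v (Suc j) - (p (Suc j) - (\<Sum>i<Suc j. d i) *s p j) \<in> span (K j)"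
    for d j
  proof (induction j)
    case 0
    then show ?case by (simp add: span_zero p_def)
  next
    case (Suc j)
    define s where "s = (\<Sum>i<Suc j. d i)"
    define x where "x = chain d v (Suc j) - (p (Suc j) - s *s p j)"
    have x: "x \<in> span (K j)" using Suc by (simp add: x_def s_def)
    have c: "chain d v (Suc j) = x + p (Suc j) - s *s p j" by (simp add: x_def)
    have "chain d v (Suc (Suc j)) - (p (Suc (Suc j)) - (s + d (Suc j)) *s p (Suc j))
        = T x - d (Suc j) *s x + (d (Suc j) * s) *s p j"
      unfolding chain.simps(2)[of d v "Suc j"] c
      by (simp add: endo.linear_add[OF T] endo.linear_diff[OF T] endo.linear_scale[OF T] Tp
          scale_left_distrib scale_right_distrib scale_right_diff_distrib)
    also have "\<dots> \<in> span (K (Suc j))"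
      using TK[OF x] K_mono[OF x] K_top[of j] by (intro span_add span_diff span_scale)
    finally show ?case by (simp add: s_def)
  qed
  have first: "chain d v j - p j \<in> span (K j)" for d j
  proof (cases j)
    case (Suc i)
    have "chain d v (Suc i) - (p (Suc i) - (\<Sum>l<Suc i. d l) *s p i)
        - (\<Sum>l<Suc i. d l) *s p i \<in> span (K (Suc i))"
      by (rule span_diff[OF K_mono[OF second] span_scale[OF K_top]])
    then show ?thesis using Suc by simp
  qed (simp add: span_zero p_def)
  have same_span: "span (U \<union> chain d v ` {..<j}) = span (K j)" for d j
  proof (induction j)
    case (Suc j)
    have "span (insert (chain d v j) (U \<union> chain d v ` {..<j}))
        = span (insert (p j) (U \<union> chain d v ` {..<j}))"
      using first[of d j] Suc by (intro eq_span_insert_eq) simp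
    also have "\<dots> = span (insert (p j) (K j))"
      unfolding span_insert Suc ..
    finally show ?case by (simp add: lessThan_Suc K_Suc)
  qed (simp add: K_def)
  have free: "chain d v j \<notin> span (U \<union> chain d v ` {..<j})" if "j < m" for d j
  proof
    assume "chain d v j \<in> span (U \<union> chain d v ` {..<j})"
    then have "chain d v j - (chain d v j - p j) \<in> span (K j)"
      using first[of d j] unfolding same_span by (rule span_diff)
    then show False using m(3)[OF that] by simp
  qed
  obtain n where n: "m = Suc n" using m(1) by (cases m) auto
  obtain t where t: "p m - t *s p n \<in> span (K n)"
    using m(2) unfolding n K_Suc span_breakdown_eq by blast
  have "chain d v m - (t - (\<Sum>i<m. d i)) *s chain d v (m - 1) \<in> span (U \<union> chain d v ` {..<m - 1})" for d
  proof -
    define s where "s = (\<Sum>i<m. d i)"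
    have "(chain d v m - (p m - s *s p n)) + (p m - t *s p n)
        - (t - s) *s (chain d v n - p n) \<in> span (K n)"
      using span_diff[OF span_add[OF second[where d = d and j = n] t[unfolded n]] span_scale[OF first]]
      unfolding s_def n .
    moreover have "(chain d v m - (p m - s *s p n)) + (p m - t *s p n)
        - (t - s) *s (chain d v n - p n) = chain d v m - (t - s) *s chain d v n"
      by (simp add: scale_right_diff_distrib scale_left_diff_distrib)
    ultimately show ?thesis
      unfolding same_span by (simp only: s_def n diff_Suc_1)
  qed
  then show ?thesis using that m(1) free by blast
qed

text \<open>
  If the shifts exhaust the trace, the last chain vector is mapped into \<open>U\<close> up to a vector \<open>y\<close> in the span
  of the earlier ones. Then the diagonalizable part has the eigenvectors \<open>e j\<close> for \<open>j < m - 1\<close>, and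
  \<open>e (m - 1)\<close> can be corrected to an eigenvector because \<open>E - c\<close>, with \<open>c = d (m - 1)\<close>, is onto the span of the
  earlier vectors: their eigenvalues differ from \<open>c\<close>.
\<close>

lemma diag_plus_nil_extend_separated:
  assumes U: "diag_plus_nil_on U" and m: "m > 0"
    and free: "\<And>j. j < m \<Longrightarrow> chain d v j \<notin> span (U \<union> chain d v ` {..<j})"
    and last: "chain d v m \<in> span (U \<union> chain d v ` {..<m - 1})"
    and separated: "\<And>j. j < m - 1 \<Longrightarrow> d j \<noteq> d (m - 1)"
  shows "diag_plus_nil_on (span (U \<union> chain d v ` {..<m}))"
proof -
  define e where "e = chain d v"
  define n where "n = m - 1"
  have mn: "m = Suc n" using m by (simp add: n_def)
  let ?S = "e ` {..<n}"
  have sU: "span U = U" using U by (simp add: diag_plus_nil_on_def)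
  obtain u y where uy: "u \<in> U" "y \<in> span ?S" "e m = u + y"
    using last unfolding span_Un sU e_def[symmetric] n_def[symmetric] by blast
  define Y where "Y j = d j *s e j + (if j = n then y else 0)" for j
  have S: "x \<in> span (e ` {..<m})" if "x \<in> span ?S" for x
    using that span_mono[OF image_mono[of "{..<n}" "{..<m}" e]] by (auto simp: mn)
  have eS: "e j \<in> span (e ` {..<m})" if "j < m" for j using that by (intro span_base) auto
  show ?thesis unfolding e_def[symmetric]
  proof (rule diag_plus_nil_extend[OF U, where y = Y])
    show "e j \<notin> span (U \<union> e ` {..<j})" if "j < m" for j using free[OF that] by (simp add: e_def)
    show "Y j \<in> span (e ` {..<m})" if "j < m" for j
      using eS[OF that] S[OF uy(2)] by (auto simp: Y_def intro: span_add span_scale)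
    show "T (e j) - Y j = e (Suc j)" if "Suc j < m" for j using that by (simp add: e_def Y_def mn)
    show "T (e (m - 1)) - Y (m - 1) \<in> U"
    proof -
      have "T (e n) = e m + d n *s e n" by (simp add: e_def mn)
      then show ?thesis using uy(1,3) by (simp add: Y_def mn)
    qed
    fix E j assume E: "lin E" and Ee: "\<And>i. i < m \<Longrightarrow> E (e i) = Y i" and j: "j < m"
    let ?eig = "{x \<in> span (e ` {..<m}). \<exists>c. E x = c *s x}"
    have low: "e i \<in> ?eig" if "i < n" for i
      using that Ee[of i] eS[of i] by (auto simp: mn Y_def)
    show "e j \<in> span ?eig"
    proof (cases "j = n")
      case False
      then show ?thesis using low[of j] j by (intro span_base) (simp add: mn)
    next
      case True
      let ?c = "d n"
      let ?L = "\<lambda>x. E x - ?c *s x"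
      have L: "lin ?L" using E by (intro endo.linear_compose_sub linear_scale_self)
      have image: "?S \<subseteq> ?L ` span ?S"
      proof (intro subsetI)
        fix z assume "z \<in> ?S"
        then obtain i where i: "i < n" "z = e i" by auto
        \<comment> \<open>On an eigenvector for \<open>d i\<close> the operator \<open>E - c\<close> is multiplication by \<open>d i - c\<close>.\<close>
        define b where "b = 1 / (d i - ?c)"
        have "b * (d i - ?c) = 1" using separated[of i] i(1) by (simp add: b_def n_def)
        then have b: "b * d i - ?c * b = 1" by (simp only: right_diff_distrib mult.commute[of ?c])
        have "E (b *s e i) - ?c *s b *s e i = (b * d i) *s e i - (?c * b) *s e i"
          using i(1) Ee[of i] by (simp add: endo.linear_scale[OF E] mn Y_def)
        also have "\<dots> = e i" unfolding scale_left_diff_distrib[symmetric] b by simp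
        finally have "e i = ?L (b *s e i)" by (rule sym)
        moreover have "b *s e i \<in> span ?S" using i by (intro span_scale span_base) auto
        ultimately show "z \<in> ?L ` span ?S" unfolding i(2) by (rule image_eqI)
      qed
      have "span ?S \<subseteq> ?L ` span ?S"
        using image by (rule span_minimal) (rule endo.linear_subspace_image[OF L subspace_span])
      then have "y \<in> ?L ` span ?S" using uy(2) by blast
      then obtain x where x: "x \<in> span ?S" "E x - ?c *s x = y" by (rule imageE) simp
      have "E (e n - x) = ?c *s e n + (E x - ?c *s x) - E x"
        using Ee[of n] unfolding x(2) by (simp add: endo.linear_diff[OF E] Y_def mn)
      then have "E (e n - x) = ?c *s (e n - x)" by (simp add: scale_right_diff_distrib)
      then have "e n - x \<in> ?eig" using eS[of n] S[OF x(1)] by (auto simp: mn intro: span_diff)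
      moreover have "x \<in> span ?eig"
        using x(1) low span_mono[of ?S ?eig] by blast
      ultimately have "(e n - x) + x \<in> span ?eig" by (intro span_add) (auto intro: span_base)
      then show ?thesis using True by simp
    qed
  qed
qed

text \<open>
  In characteristic 2 with \<open>r\<^sup>2 = r\<close> the polynomial \<open>X\<^sup>2 - r\<close> equals \<open>(X - r)\<^sup>2\<close>, so \<open>T\<close> acts on the new
  piece as the scalar \<open>r\<close> plus a nilpotent operator.
\<close>

lemma diag_plus_nil_extend_two:
  fixes r :: 'k
  assumes U: "diag_plus_nil_on U" and two: "(1::'k) + 1 = 0" and r: "r * r = r"
    and free: "\<And>j. j < 2 \<Longrightarrow> chain (\<lambda>_. r) v j \<notin> span (U \<union> chain (\<lambda>_. r) v ` {..<j})"
    and last: "T (T v) - r *s v \<in> U"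
  shows "diag_plus_nil_on (span (U \<union> chain (\<lambda>_. r) v ` {..<2}))"
proof (rule diag_plus_nil_extend[OF U free, where y = "\<lambda>j. r *s chain (\<lambda>_. r) v j"])
  let ?e = "chain (\<lambda>_. r) v"
  have base: "?e j \<in> span (?e ` {..<2})" if "j < 2" for j using that by (intro span_base) auto
  show "r *s ?e j \<in> span (?e ` {..<2})" if "j < 2" for j using base[OF that] by (rule span_scale)
  have rr: "r + r = 0" using two by (metis distrib_left mult.right_neutral mult_zero_right)
  have "r *s T v + r *s T v = 0" "r *s v + r *s v = 0"
    by (simp_all add: scale_left_distrib[symmetric] rr)
  then have "T (?e 1) - r *s ?e 1 = T (T v) - r *s v"
    by (simp add: endo.linear_diff[OF T] endo.linear_scale[OF T] scale_right_diff_distrib r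
        add_eq_0_iff diff_diff_add[symmetric] del: diff_diff_add)
  then show "T (?e (2 - 1)) - r *s ?e (2 - 1) \<in> U" using last by simp
  show "?e j \<in> span {x \<in> span (?e ` {..<2}). \<exists>c. E x = c *s x}"
    if "\<And>i. i < 2 \<Longrightarrow> E (?e i) = r *s ?e i" "j < 2" for E j
    using that base[OF that(2)] by (intro span_base) blast
qed auto

text \<open>
  Here the diagonalizable part has eigenvalue \<open>1\<close> on the first \<open>n + 1\<close> vectors and a two-dimensional
  kernel. Changing the last vector by \<open>s\<close> times \<open>e n\<close> removes the coefficient of \<open>e (n + 1)\<close> in the image
  of the last vector, which would otherwise prevent the two remaining vectors from being corrected to
  elements of the kernel.
\<close>

lemma diag_plus_nil_extend_three:
  fixes e :: "nat \<Rightarrow> 'v"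
  assumes U: "diag_plus_nil_on U"
    and free: "\<And>j. j < n + 3 \<Longrightarrow> e j \<notin> span (U \<union> e ` {..<j})"
    and step: "\<And>j. j \<le> n \<Longrightarrow> T (e j) - e j = e (Suc j)" and step': "T (e (n + 1)) = e (n + 2)"
    and last: "T (e (n + 2)) - s *s e (n + 1) - k \<in> U" and k: "k \<in> span (e ` {..<n + 1})"
  shows "diag_plus_nil_on (span (U \<union> (e(n + 2 := e (n + 2) - s *s e n)) ` {..<n + 3}))"
proof -
  define e' where "e' = e(n + 2 := e (n + 2) - s *s e n)"
  define Y where "Y j = (if j \<le> n then e j else if j = n + 1 then s *s e n else k - s *s e n)" for j
  have e': "e' j = e j" if "j \<le> n + 1" for j using that by (simp add: e'_def)
  have e'_top: "e' (n + 2) = e (n + 2) - s *s e n" by (simp add: e'_def)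
  have image: "e' ` {..<j} = e ` {..<j}" if "j \<le> n + 2" for j
    using that by (intro image_cong) (auto simp: e'_def)
  have base: "e' j \<in> span (e' ` {..<n + 3})" if "j < n + 3" for j
    using that by (intro span_base) auto
  have low: "x \<in> span (e' ` {..<n + 3})" if "x \<in> span (e ` {..<n + 1})" for x
    using that span_mono[OF image_mono[of "{..<n + 1}" "{..<n + 3}" e']] image[of "n + 1"] by auto
  have en: "e n \<in> span (e ` {..<n + 1})" by (intro span_base) auto
  have kn: "k - s *s e n \<in> span (e ` {..<n + 1})" using k en by (intro span_diff span_scale)
  show ?thesis unfolding e'_def[symmetric]
  proof (rule diag_plus_nil_extend[OF U, where y = Y])
    show "e' j \<notin> span (U \<union> e' ` {..<j})" if j: "j < n + 3" for j
    proof (cases "j = n + 2")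
      case True
      have "s *s e n \<in> span (U \<union> e ` {..<n + 2})" by (intro span_scale span_base) auto
      then have "e' j \<notin> span (U \<union> e ` {..<n + 2})"
        using free[of "n + 2"] span_add[of "e' j" "U \<union> e ` {..<n + 2}" "s *s e n"] True
        using e'_top by auto
      then show ?thesis using True image[of "n + 2"] by simp
    next
      case False
      then show ?thesis using free[OF j] e'[of j] image[of j] j by simp
    qed
    show "Y j \<in> span (e' ` {..<n + 3})" if "j < n + 3" for j
      using base[OF that] e'[of j] low[OF kn] low[OF en] by (auto simp: Y_def intro: span_scale)
    show "T (e' j) - Y j = e' (Suc j)" if "Suc j < n + 3" for j
    proof (cases "j \<le> n")
      case True
      then show ?thesis using step[OF True] e'[of j] e'[of "Suc j"] by (simp add: Y_def)
    next
      case False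
      then have "j = n + 1" using that by simp
      then show ?thesis using step' e'[of "n + 1"] e'_top by (simp add: Y_def)
    qed
    have "T (e n) = e n + e (n + 1)" using step[of n] by (simp add: diff_eq_eq add.commute)
    then have "T (e' (n + 2)) - Y (n + 2) = T (e (n + 2)) - s *s e (n + 1) - k"
      unfolding e'_top
      by (simp add: Y_def endo.linear_diff[OF T] endo.linear_scale[OF T] scale_right_distrib)
    then show "T (e' (n + 3 - 1)) - Y (n + 3 - 1) \<in> U" using last by simp
  next
    fix E j assume E: "lin E" and Ee: "\<And>i. i < n + 3 \<Longrightarrow> E (e' i) = Y i" and j: "j < n + 3"
    let ?eig = "{x \<in> span (e' ` {..<n + 3}). \<exists>c. E x = c *s x}"
    have id_low: "E x = x" if "x \<in> span (e ` {..<n + 1})" for x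
      using that
    proof (rule endo.linear_eq_on[OF E linear_ident])
      show "E b = b" if "b \<in> e ` {..<n + 1}" for b
      proof -
        obtain i where i: "b = e i" "i \<le> n" using \<open>b \<in> e ` {..<n + 1}\<close> by auto
        then show ?thesis using Ee[of i] e'[of i] by (simp add: Y_def)
      qed
    qed
    have eig_low: "x \<in> span ?eig" if "x \<in> span (e ` {..<n + 1})" for x
      using id_low[OF that] low[OF that] by (intro span_base) (auto intro: exI[of _ 1])
    have kernel: "e' i \<in> span ?eig" if "i < n + 3" "Y i \<in> span (e ` {..<n + 1})" for i
    proof -
      have "E (e' i - Y i) = 0 *s (e' i - Y i)"
        using Ee[OF that(1)] id_low[OF that(2)] by (simp add: endo.linear_diff[OF E])
      then have "e' i - Y i \<in> span ?eig"
        using base[OF that(1)] low[OF that(2)] by (intro span_base) (auto intro: span_diff)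
      from span_add[OF this eig_low[OF that(2)]] show ?thesis by simp
    qed
    have "Y j \<in> span (e ` {..<n + 1})"
      using en kn by (auto simp: Y_def intro: span_scale span_base)
    then show "e' j \<in> span ?eig" using kernel j by blast
  qed
qed

text \<open>
  Over the two-element field the shifts \<open>0, \<dots>, 0, 1\<close> settle trace \<open>1\<close> and the shifts \<open>1, \<dots>, 1, 0\<close> settle trace
  \<open>m - 1\<close>. There remains the case of trace \<open>0\<close> and even \<open>m\<close>, where the dimension \<open>2\<close> is exceptional.
\<close>

lemma diag_plus_nil_extend_by_vector:
  assumes U: "diag_plus_nil_on U" "U \<subseteq> span B"
    and B: "T ` span B \<subseteq> span B" "finite B" and v: "v \<in> span B" "v \<notin> U"
    and field: "(2::'k) \<noteq> 0 \<or> (\<forall>x::'k. x = 0 \<or> x = 1)"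
  shows "\<exists>U'. diag_plus_nil_on U' \<and> insert v U \<subseteq> U' \<and> U' \<subseteq> span B"
proof -
  have TU: "T ` U \<subseteq> U" and sU: "subspace U" and spU: "span U = U"
    using U(1) by (auto simp: diag_plus_nil_on_def)
  obtain m t where m: "m > 0"
    and free: "\<And>d j. j < m \<Longrightarrow> chain d v j \<notin> span (U \<union> chain d v ` {..<j})"
    and top: "\<And>d. chain d v m - (t - (\<Sum>i<m. d i)) *s chain d v (m - 1)
       \<in> span (U \<union> chain d v ` {..<m - 1})"
    using krylov_chain[OF TU B, of v] v spU by metis
  have chain_B: "chain d v j \<in> span B" for d j
  proof (induction j)
    case (Suc j)
    have "T (chain d v j) \<in> span B" using B(1) Suc by blast
    then show ?case using Suc by (simp add: span_diff span_scale)
  qed (simp add: v)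
  have enough: ?thesis if "diag_plus_nil_on (span (U \<union> e ` {..<m}))" "e 0 = v" "\<And>j. e j \<in> span B" for e
  proof (intro exI conjI)
    show "insert v U \<subseteq> span (U \<union> e ` {..<m})"
      using that(2) m by (auto intro!: span_base)
    show "span (U \<union> e ` {..<m}) \<subseteq> span B"
      using U(2) that(3) by (intro span_minimal) auto
  qed (rule that(1))
  show ?thesis
  proof (cases "\<exists>d. (\<Sum>i<m. d i) = t \<and> (\<forall>j<m - 1. d j \<noteq> d (m - 1))")
    case True
    then obtain d where d: "(\<Sum>i<m. d i) = t" "\<And>j. j < m - 1 \<Longrightarrow> d j \<noteq> d (m - 1)" by blast
    have "diag_plus_nil_on (span (U \<union> chain d v ` {..<m}))"
      using top[of d] d by (intro diag_plus_nil_extend_separated[OF U(1) m free]) auto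
    then show ?thesis using chain_B by (intro enough[of "chain d v"]) simp_all
  next
    case False
    then have bin: "\<And>x::'k. x = 0 \<or> x = 1"
      using field trace_as_separated_sum[OF _ m, of t] by blast
    have two: "(1::'k) + 1 = 0" using bin[of "1 + 1"] by (metis add_cancel_left_left one_neq_zero)
    \<comment> \<open>All shifts \<open>c\<close> but the last, which is the other element \<open>1 - c\<close> of the field.\<close>
    define const where "const c = (\<lambda>j. if j = m - 1 then 1 - c else (c::'k))" for c
    have "(\<Sum>i<m. const c i) = of_nat (m - 1) * c + (1 - c)" for c
    proof -
      have "(\<Sum>i<m. const c i) = (\<Sum>i<m - 1. const c i) + const c (m - 1)"
        using m sum.lessThan_Suc[of "const c" "m - 1"] by simp
      also have "(\<Sum>i<m - 1. const c i) = (\<Sum>i<m - 1. c)" by (intro sum.cong) (auto simp: const_def)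
      finally show ?thesis by (simp add: const_def)
    qed
    moreover have "\<forall>j<m - 1. const c j \<noteq> const c (m - 1)" for c
    proof -
      have "c \<noteq> 1 - c" using bin[of c] by (metis diff_zero diff_self one_neq_zero)
      then show ?thesis by (simp add: const_def)
    qed
    ultimately have "of_nat (m - 1) * c + (1 - c) \<noteq> t" for c using False by blast
    from this[of 0] this[of 1] have t: "t = 0" and m1: "of_nat (m - 1) = (1::'k)"
      using bin[of t] bin[of "of_nat (m - 1)"] by auto
    have "m \<noteq> 1" using m1 by auto
    then have "m = 2 \<or> m = (m - 3) + 3" using m by linarith
    then consider "m = 2" | n where "m = n + 3" by blast
    then show ?thesis
    proof cases
      case 1
      have "T (T v) \<in> span (insert v U)" using top[of "\<lambda>_. 0"] 1 t
        by (simp add: numeral_2_eq_2 lessThan_Suc)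
      then obtain r where r: "T (T v) - r *s v \<in> U" unfolding span_breakdown_eq spU by blast
      have "r * r = r" using bin[of r] by auto
      then have "diag_plus_nil_on (span (U \<union> chain (\<lambda>_. r) v ` {..<2}))"
        using free[of _ "\<lambda>_. r"] 1 by (intro diag_plus_nil_extend_two[OF U(1) two _ _ r]) auto
      then show ?thesis using 1 chain_B by (intro enough[of "chain (\<lambda>_. r) v"]) simp_all
    next
      case (2 n)
      \<comment> \<open>The shifts \<open>1, \<dots>, 1, 0, 0\<close> have sum \<open>m - 2\<close>, which is the trace \<open>0\<close> as \<open>m\<close> is even.\<close>
      define d where "d j = (if j \<le> n then 1 else 0 :: 'k)" for j
      define e where "e = chain d v"
      have "(\<Sum>i<m. d i) = (\<Sum>i<n + 1. d i)"
        using 2 by (intro sum.mono_neutral_right) (auto simp: d_def)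
      also have "\<dots> = (\<Sum>i<n + 1. 1)" by (intro sum.cong) (auto simp: d_def)
      also have "\<dots> = of_nat (m - 1) + 1" using two by (simp add: 2 add.commute add.left_commute)
      finally have "(\<Sum>i<m. d i) = 0" using m1 two by simp
      then have "e (n + 3) \<in> span (insert (e (n + 1)) (U \<union> e ` {..<n + 1}))"
        using top[of d] t by (simp add: 2 e_def lessThan_Suc)
      then obtain s where "e (n + 3) - s *s e (n + 1) \<in> span (U \<union> e ` {..<n + 1})"
        unfolding span_breakdown_eq by blast
      then obtain u k where uk: "u \<in> U" "k \<in> span (e ` {..<n + 1})" "e (n + 3) - s *s e (n + 1) = u + k"
        unfolding span_Un spU by blast
      have e3: "e (n + 3) = T (e (n + 2))" by (simp add: e_def d_def numeral_3_eq_3)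
      have "diag_plus_nil_on (span (U \<union> (e(n + 2 := e (n + 2) - s *s e n)) ` {..<n + 3}))"
      proof (rule diag_plus_nil_extend_three[OF U(1)])
        show "e j \<notin> span (U \<union> e ` {..<j})" if "j < n + 3" for j using free that 2 by (simp add: e_def)
        show "T (e (n + 2)) - s *s e (n + 1) - k \<in> U" using uk(1) unfolding e3[symmetric] uk(3) by simp
      qed (use uk(2) in \<open>auto simp: e_def d_def\<close>)
      then show ?thesis unfolding 2[symmetric]
      proof (rule enough)
        show "(e(n + 2 := e (n + 2) - s *s e n)) j \<in> span B" for j
          using chain_B[of d] by (simp add: e_def span_diff span_scale del: chain.simps)
      qed (simp add: e_def)
    qed
  qed
qed

text \<open>
  The generators are adjoined one after the other. The fields left out are those of characteristic 2 with
  more than two elements, where the choices of shifts above can fail.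
\<close>

theorem diag_plus_nil_on_span:
  assumes B: "T ` span B \<subseteq> span B" "finite B"
    and field: "(2::'k) \<noteq> 0 \<or> (\<forall>x::'k. x = 0 \<or> x = 1)"
  shows "diag_plus_nil_on (span B)"
proof -
  have "\<exists>U. diag_plus_nil_on U \<and> C \<subseteq> U \<and> U \<subseteq> span B" if "finite C" "C \<subseteq> B" for C
    using that
  proof (induction C)
    case empty
    have "diag_plus_nil_on {0}"
      unfolding diag_plus_nil_on_def
      by (intro conjI exI[of _ "\<lambda>_. 0"] exI[of _ 1])
        (auto simp: endo.linear_zero endo.linear_0[OF T] span_zero)
    then show ?case using span_zero by blast
  next
    case (insert v C)
    then obtain U where U: "diag_plus_nil_on U" "C \<subseteq> U" "U \<subseteq> span B" by auto
    have v: "v \<in> span B" using insert.prems by (auto intro: span_base)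
    show ?case
    proof (cases "v \<in> U")
      case False
      then show ?thesis using diag_plus_nil_extend_by_vector[OF U(1,3) B v False field] U(2) by blast
    qed (use U in blast)
  qed
  then obtain U where "diag_plus_nil_on U" "B \<subseteq> U" "U \<subseteq> span B" using B(2) by blast
  moreover from this have "span B = U"
    by (intro span_subspace) (auto simp: diag_plus_nil_on_def)
  ultimately show ?thesis by simp
qed

text \<open>
  If all scalars are \<open>0\<close>, \<open>1\<close> or \<open>-1\<close>, then \<open>G\<close> and \<open>Q\<close> are the projections of the diagonalizable part onto
  its eigenspaces for \<open>1\<close> and \<open>-1\<close>. In characteristic 3 the interpolation polynomials are \<open>-(X\<^sup>2 + X)\<close> and
  \<open>X - X\<^sup>2\<close>; in characteristic 2 the two eigenvalues coincide and \<open>Q = 0\<close>.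
\<close>

theorem signed_idempotents_plus_nilpotent:
  assumes B: "T ` span B \<subseteq> span B" "finite B"
    and field: "(\<forall>c::'k. c = 0 \<or> c = 1) \<or> (1::'k) + 1 + 1 = 0 \<and> (\<forall>c::'k. c = 0 \<or> c = 1 \<or> c = - 1)"
  obtains G Q W k where "lin G" "lin Q" "lin W"
    "G ` span B \<subseteq> span B" "Q ` span B \<subseteq> span B" "W ` span B \<subseteq> span B"
    "\<And>x. x \<in> span B \<Longrightarrow> G (G x) = G x" "\<And>x. x \<in> span B \<Longrightarrow> Q (Q x) = Q x"
    "\<And>x. x \<in> span B \<Longrightarrow> G (Q x) = 0" "\<And>x. x \<in> span B \<Longrightarrow> Q (G x) = 0"
    "\<And>x. x \<in> span B \<Longrightarrow> T x + Q x = G x + W x" "\<And>x. x \<in> span B \<Longrightarrow> (W ^^ k) x = 0"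
proof -
  have "(1::'k) + 1 \<noteq> 0" if "(1::'k) + 1 + 1 = 0"
  proof
    assume "(1::'k) + 1 = 0"
    then show False using that by simp
  qed
  then have "(2::'k) \<noteq> 0 \<or> (\<forall>c::'k. c = 0 \<or> c = 1)" using field by auto
  from diag_plus_nil_on_span[OF B this]
  obtain E k where E: "lin E" "E ` span B \<subseteq> span B"
    and eig: "span B \<subseteq> span {x \<in> span B. \<exists>c. E x = c *s x}"
    and nil: "\<And>x. x \<in> span B \<Longrightarrow> ((\<lambda>x. T x - E x) ^^ k) x = 0"
    unfolding diag_plus_nil_on_def by blast
  have check: "L x = L' x"
    if "lin L" "lin L'" "x \<in> span B" "\<And>c y. E y = c *s y \<Longrightarrow> L y = L' y" for L L' x
  proof (rule endo.linear_eq_on[OF that(1,2) subsetD[OF eig that(3)]])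
    fix b assume "b \<in> {x \<in> span B. \<exists>c. E x = c *s x}"
    then obtain c where "E b = c *s b" by blast
    then show "L b = L' b" by (rule that(4))
  qed
  have Es: "E (c *s x) = c *s E x" for c x by (rule endo.linear_scale[OF E(1)])
  have EB: "E x \<in> span B" if "x \<in> span B" for x using E(2) that by blast
  have TB: "T x \<in> span B" if "x \<in> span B" for x using B(1) that by blast
  define W where "W = (\<lambda>x. T x - E x)"
  have W: "lin W" unfolding W_def by (rule endo.linear_compose_sub[OF T E(1)])
  have WB: "W ` span B \<subseteq> span B" using EB TB span_diff by (auto simp: W_def)
  from field show ?thesis
  proof
    assume bin: "\<forall>c::'k. c = 0 \<or> c = 1"
    have "E (E x) = E x" if "x \<in> span B" for x
    proof (rule check[OF _ E(1) that])
      show "lin (\<lambda>x. E (E x))" using Vector_Spaces.linear_compose[OF E(1) E(1)] by (simp add: o_def)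
      show "E (E y) = E y" if "E y = c *s y" for c y
        using that bin[rule_format, of c] by (auto simp: Es)
    qed
    then show ?thesis
      using E W WB nil endo.linear_zero endo.linear_0[OF E(1)] span_zero
      by (intro that[of E "\<lambda>_. 0" W k]) (auto simp: W_def)
  next
    assume tern: "(1::'k) + 1 + 1 = 0 \<and> (\<forall>c::'k. c = 0 \<or> c = 1 \<or> c = - 1)"
    have EE: "lin (\<lambda>x. E (E x))" using Vector_Spaces.linear_compose[OF E(1) E(1)] by (simp add: o_def)
    have three: "x + (x + x) = 0" for x :: 'v
    proof -
      have "x + (x + x) = (1 + 1 + 1) *s x" by (simp only: scale_left_distrib scale_one add.assoc)
      then show ?thesis using tern by simp
    qed
    define G where "G = (\<lambda>x. - (E (E x) + E x))"
    define Q where "Q = (\<lambda>x. E x - E (E x))"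
    have G: "lin G" unfolding G_def by (rule endo.linear_compose_neg[OF endo.linear_compose_add[OF EE E(1)]])
    have Q: "lin Q" unfolding Q_def by (rule endo.linear_compose_sub[OF E(1) EE])
    have GB: "G ` span B \<subseteq> span B" unfolding G_def using EB by (blast intro: span_neg span_add)
    have QB: "Q ` span B \<subseteq> span B" using EB span_diff by (auto simp: Q_def)
    have comp: "lin (\<lambda>x. f (g x))" if "lin f" "lin g" for f g
      using Vector_Spaces.linear_compose[OF that(2,1)] by (simp add: o_def)
    have E0: "E 0 = 0" and Em: "E (- x) = - E x" for x
      by (rule endo.linear_0[OF E(1)], rule endo.linear_neg[OF E(1)])
    have neg3: "- (x + x) = x" for x :: 'v
      by (rule minus_unique) (simp only: add.assoc three)
    have eigen: "E y = 0 \<and> G y = 0 \<and> Q y = 0 \<or> E y = y \<and> G y = y \<and> Q y = 0 \<or>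
        E y = - y \<and> G y = 0 \<and> Q y = y" if "E y = c *s y" for c y
    proof -
      have "c = 0 \<or> c = 1 \<or> c = - 1" using tern by simp
      then have "E y = 0 \<or> E y = y \<or> E y = - y" using that by (elim disjE) simp_all
      then consider "E y = 0" | "E y = y" | "E y = - y" by blast
      then show ?thesis
      proof cases
        case 3
        then have "Q y = - (y + y)" by (simp add: Q_def Em)
        then have "Q y = y" unfolding neg3 .
        then show ?thesis using 3 by (simp add: G_def Em)
      next
        case 2
        have "G y = - (y + y)" unfolding G_def 2 ..
        then have "G y = y" unfolding neg3 .
        then show ?thesis using 2 by (simp add: Q_def)
      qed (simp add: G_def Q_def E0)
    qed
    have z: "G 0 = 0" "Q 0 = 0" by (simp_all add: G_def Q_def E0)
    show ?thesis
    proof (rule that[OF G Q W GB QB WB])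
      fix x assume x: "x \<in> span B"
      show "G (G x) = G x"
        by (rule check[OF comp[OF G G] G x]) (drule eigen, elim disjE conjE, simp_all add: z)
      show "Q (Q x) = Q x"
        by (rule check[OF comp[OF Q Q] Q x]) (drule eigen, elim disjE conjE, simp_all add: z)
      show "G (Q x) = 0"
        by (rule check[OF comp[OF G Q] endo.linear_zero x]) (drule eigen, elim disjE conjE, simp_all add: z)
      show "Q (G x) = 0"
        by (rule check[OF comp[OF Q G] endo.linear_zero x]) (drule eigen, elim disjE conjE, simp_all add: z)
      have "Q x + E x = G x"
        by (rule check[OF endo.linear_compose_add[OF Q E(1)] G x]) (drule eigen, elim disjE conjE, simp_all)
      then show "T x + Q x = G x + W x" by (simp add: W_def algebra_simps)
      show "(W ^^ k) x = 0" using nil[OF x] by (simp add: W_def)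
    qed
  qed
qed

end

section \<open>Matrices over the prime radical\<close>

lemma (in ideal) finsum_mem:
  assumes "finite A" "\<And>k. k \<in> A \<Longrightarrow> f k \<in> I"
  shows "(\<Oplus>k\<in>A. f k) \<in> I"
  using assms
proof (induction A)
  case (insert x F)
  then have "(\<Oplus>k\<in>insert x F. f k) = f x \<oplus> (\<Oplus>k\<in>F. f k)"
    by (intro finsum_insert) (auto simp: Icarr)
  then show ?case using insert by simp
qed simp

lemma (in ring) prime_radical_ideal: "ideal (prime_radical R) R"
proof -
  have "prime_radical R = \<Inter>(insert (carrier R) {P. nc_prime_ideal P R})"
    by (auto simp: prime_radical_def)
  moreover have "ideal P R" if "P \<in> insert (carrier R) {P. nc_prime_ideal P R}" for P
    using that oneideal by (auto simp: nc_prime_ideal_def)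
  ultimately show ?thesis
    using i_Intersect[of "insert (carrier R) {P. nc_prime_ideal P R}"] by simp
qed

definition mat_entries :: "nat \<Rightarrow> 'a mat \<Rightarrow> 'a set" where
  "mat_entries n A = (\<lambda>(i, j). A $$ (i, j)) ` ({..<n} \<times> {..<n})"

lemma finite_mat_entries: "finite (mat_entries n A)"
  by (simp add: mat_entries_def)

lemma mat_entries_subset_iff: "mat_entries n A \<subseteq> I \<longleftrightarrow> (\<forall>i<n. \<forall>j<n. A $$ (i, j) \<in> I)"
  by (auto simp: mat_entries_def)

lemma carrier_matrix_ring:
  "A \<in> carrier (matrix_ring n R) \<longleftrightarrow> A \<in> carrier_mat n n \<and> mat_entries n A \<subseteq> carrier R"
  by (simp add: matrix_ring_def mat_entries_subset_iff)

lemma (in ring) mat_entries_mult: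
  assumes "ideal I R" "ideal J R" "ideal P R"
    and "\<And>x y. x \<in> I \<Longrightarrow> y \<in> J \<Longrightarrow> x \<otimes> y \<in> P"
    and "mat_entries n A \<subseteq> I" "mat_entries n B \<subseteq> J"
  shows "mat_entries n (A \<otimes>\<^bsub>matrix_ring n R\<^esub> B) \<subseteq> P"
  using assms(4-6)
  by (auto simp: mat_entries_subset_iff matrix_ring_def intro!: ideal.finsum_mem[OF assms(3)])

text \<open>
  A direct form of the fact that the prime radical is locally nilpotent. If no power of \<open>A\<close> vanishes,
  Zorn's lemma gives an ideal \<open>P\<close> maximal among the ideals that contain the entries of no power of \<open>A\<close>;
  unions of chains stay in this family because a matrix has finitely many entries. If \<open>I\<close> and \<open>J\<close> are not
  contained in \<open>P\<close>, then \<open>P + I\<close> and \<open>P + J\<close> contain the entries of some \<open>A\<^sup>k\<close> and \<open>A\<^sup>l\<close>, so \<open>I J \<subseteq> P\<close>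
  would put those of \<open>A\<^sup>k\<^sup>+\<^sup>l\<close> into \<open>P\<close>. Hence \<open>P\<close> is prime, and the entries of \<open>A\<close> itself lie in it.
\<close>

theorem (in ring) matrix_over_prime_radical_nilpotent:
  assumes A: "A \<in> carrier (matrix_ring n R)" and rad: "mat_entries n A \<subseteq> prime_radical R"
  shows "nilpotent_elem (matrix_ring n R) A"
proof (rule ccontr)
  let ?M = "matrix_ring n R"
  interpret M: ring ?M by (rule ring_matrix_ring)
  assume not_nil: "\<not> ?thesis"
  let ?F = "{I. ideal I R \<and> (\<forall>k::nat. \<not> mat_entries n (A [^]\<^bsub>?M\<^esub> k) \<subseteq> I)}"
  have zero_mem: "{\<zero>} \<in> ?F"
  proof (clarsimp simp: zeroideal)
    fix k :: nat assume k: "mat_entries n (A [^]\<^bsub>?M\<^esub> k) \<subseteq> {\<zero>}"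
    have "A [^]\<^bsub>?M\<^esub> k \<in> carrier ?M" using A by simp
    then have "A [^]\<^bsub>?M\<^esub> k = \<zero>\<^bsub>?M\<^esub>"
      using k by (auto simp: matrix_ring_def mat_entries_subset_iff intro!: eq_matI)
    then have "A [^]\<^bsub>?M\<^esub> Suc k = \<zero>\<^bsub>?M\<^esub>" using A by simp
    then show False using not_nil A by (auto simp: nilpotent_elem_def simp del: M.nat_pow_Suc)
  qed
  have Union_mem: "\<Union>C \<in> ?F" if C: "C \<noteq> {}" "subset.chain ?F C" for C
  proof -
    have sub: "I \<in> ?F" if "I \<in> C" for I
      using C(2) that unfolding subset_chain_def by blast
    have "subset.chain {I. ideal I R} C" using C(2) unfolding subset_chain_def by blast
    then have "ideal (\<Union>C) R" using chain_Union_is_ideal[of C] C(1) by simp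
    moreover have "\<not> mat_entries n (A [^]\<^bsub>?M\<^esub> k) \<subseteq> \<Union>C" for k :: nat
    proof
      assume "mat_entries n (A [^]\<^bsub>?M\<^esub> k) \<subseteq> \<Union>C"
      then obtain I where "I \<in> C" "mat_entries n (A [^]\<^bsub>?M\<^esub> k) \<subseteq> I"
        by (rule finite_subset_Union_chain[OF finite_mat_entries _ C])
      then show False using sub by simp
    qed
    ultimately show ?thesis by simp
  qed
  have "\<exists>P\<in>?F. \<forall>X\<in>?F. P \<subseteq> X \<longrightarrow> X = P"
  proof (rule subset_Zorn_nonempty)
    show "?F \<noteq> {}" using zero_mem by (rule ex_in_conv[THEN iffD1, OF exI])
  qed (rule Union_mem)
  then obtain P where PF: "P \<in> ?F" and P_max: "\<forall>X\<in>?F. P \<subseteq> X \<longrightarrow> X = P" by (rule bexE)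
  have P: "ideal P R" "\<And>k::nat. \<not> mat_entries n (A [^]\<^bsub>?M\<^esub> k) \<subseteq> P" using PF by simp_all
  have max: "\<exists>k::nat. mat_entries n (A [^]\<^bsub>?M\<^esub> k) \<subseteq> X" if "ideal X R" "P \<subseteq> X" "X \<noteq> P" for X
  proof (rule ccontr)
    assume "\<not> ?thesis"
    then have "X \<in> ?F" using that(1) by simp
    then show False using P_max that(2,3) by simp
  qed
  interpret P: ideal P R by (rule P(1))
  have "nc_prime_ideal P R" unfolding nc_prime_ideal_def
  proof (intro conjI allI impI)
    show "P \<noteq> carrier R"
      using P(2)[of 0] M.nat_pow_closed[OF A, of 0] by (auto simp: carrier_matrix_ring)
    fix I J assume I: "ideal I R" and J: "ideal J R" and IJ: "ideal_prod R I J \<subseteq> P"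
    interpret I: ideal I R by (rule I)
    interpret J: ideal J R by (rule J)
    show "I \<subseteq> P \<or> J \<subseteq> P"
    proof (rule ccontr)
      assume neg: "\<not> ?thesis"
      have sum: "ideal (P <+>\<^bsub>R\<^esub> I) R" "ideal (P <+>\<^bsub>R\<^esub> J) R" by (intro add_ideals P I J)+
      have incl: "P \<subseteq> P <+>\<^bsub>R\<^esub> X" "X \<subseteq> P <+>\<^bsub>R\<^esub> X" if "ideal X R" for X
      proof -
        interpret X: ideal X R by (rule that)
        have "p \<oplus> x \<in> P <+>\<^bsub>R\<^esub> X" if "p \<in> P" "x \<in> X" for p x
          using that by (auto simp: set_add_def')
        from this[of _ \<zero>] this[of \<zero>] show "P \<subseteq> P <+>\<^bsub>R\<^esub> X" "X \<subseteq> P <+>\<^bsub>R\<^esub> X"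
          using P.Icarr X.Icarr by auto
      qed
      have ne: "P <+>\<^bsub>R\<^esub> I \<noteq> P" "P <+>\<^bsub>R\<^esub> J \<noteq> P"
        using neg incl(2)[OF I] incl(2)[OF J] by auto
      obtain k :: nat where k: "mat_entries n (A [^]\<^bsub>?M\<^esub> k) \<subseteq> P <+>\<^bsub>R\<^esub> I"
        using max[OF sum(1) incl(1)[OF I] ne(1)] by (rule exE)
      obtain l :: nat where l: "mat_entries n (A [^]\<^bsub>?M\<^esub> l) \<subseteq> P <+>\<^bsub>R\<^esub> J"
        using max[OF sum(2) incl(1)[OF J] ne(2)] by (rule exE)
      have "mat_entries n (A [^]\<^bsub>?M\<^esub> k \<otimes>\<^bsub>?M\<^esub> A [^]\<^bsub>?M\<^esub> l) \<subseteq> P"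
      proof (rule mat_entries_mult[OF sum P(1) _ k l])
        fix x y assume "x \<in> P <+>\<^bsub>R\<^esub> I" "y \<in> P <+>\<^bsub>R\<^esub> J"
        then obtain p i q j where *: "x = p \<oplus> i" "y = q \<oplus> j" "p \<in> P" "i \<in> I" "q \<in> P" "j \<in> J"
          by (auto simp: set_add_def')
        then have c: "p \<in> carrier R" "i \<in> carrier R" "q \<in> carrier R" "j \<in> carrier R"
          by (auto simp: P.Icarr I.Icarr J.Icarr)
        have "i \<otimes> j \<in> P" using IJ ideal_prod.prod[of i I j J R] * by blast
        moreover have "x \<otimes> y = p \<otimes> (q \<oplus> j) \<oplus> (i \<otimes> q \<oplus> i \<otimes> j)"
          using c by (simp add: * l_distr r_distr a_ac)
        ultimately show "x \<otimes> y \<in> P" using * c by (simp add: P.I_l_closed P.I_r_closed)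
      qed
      then show False using P(2)[of "k + l"] A by (simp add: M.nat_pow_mult)
    qed
  qed (rule P(1))
  then have "prime_radical R \<subseteq> P" by (auto simp: prime_radical_def)
  then show False using rad P(2)[of 1] A by auto
qed

lemma matrix_ring_hom:
  assumes "ring_hom_ring R S h"
  shows "ring_hom_ring (matrix_ring n R) (matrix_ring n S) (\<lambda>A. mat n n (\<lambda>(i, j). h (A $$ (i, j))))"
proof -
  interpret ring_hom_ring R S h by (rule assms)
  show ?thesis
  proof (rule ring_hom_ringI2)
    show "ring (matrix_ring n R)" "ring (matrix_ring n S)"
      by (rule R.ring_matrix_ring S.ring_matrix_ring)+
    show "(\<lambda>A. mat n n (\<lambda>(i, j). h (A $$ (i, j)))) \<in> Ring.ring_hom (matrix_ring n R) (matrix_ring n S)"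
    proof (rule ring_hom_memI)
      fix A B assume A: "A \<in> carrier (matrix_ring n R)" and B: "B \<in> carrier (matrix_ring n R)"
      have c: "\<And>i j. i < n \<Longrightarrow> j < n \<Longrightarrow> A $$ (i, j) \<in> carrier R"
        "\<And>i j. i < n \<Longrightarrow> j < n \<Longrightarrow> B $$ (i, j) \<in> carrier R"
        using A B by (auto simp: matrix_ring_def)
      show "mat n n (\<lambda>(i, j). h ((A \<otimes>\<^bsub>matrix_ring n R\<^esub> B) $$ (i, j)))
        = mat n n (\<lambda>(i, j). h (A $$ (i, j))) \<otimes>\<^bsub>matrix_ring n S\<^esub> mat n n (\<lambda>(i, j). h (B $$ (i, j)))"
        using c by (auto simp: matrix_ring_def intro!: eq_matI S.finsum_cong')
      show "mat n n (\<lambda>(i, j). h ((A \<oplus>\<^bsub>matrix_ring n R\<^esub> B) $$ (i, j)))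
        = mat n n (\<lambda>(i, j). h (A $$ (i, j))) \<oplus>\<^bsub>matrix_ring n S\<^esub> mat n n (\<lambda>(i, j). h (B $$ (i, j)))"
        using c by (auto simp: matrix_ring_def intro!: eq_matI)
    qed (auto simp: matrix_ring_def intro!: eq_matI)
  qed
qed

section \<open>Differences of orthogonal idempotents plus nilpotents\<close>

text \<open>
  Tripotents need not lift modulo a nil ideal in characteristic 2, whereas orthogonal idempotents always
  do. This form of a tripotent plus a nilpotent is therefore the one that can be transported from a quotient.
\<close>

definition signed_nil_clean_elem :: "('a, 'm) ring_scheme \<Rightarrow> 'a \<Rightarrow> bool" where
  "signed_nil_clean_elem R a \<longleftrightarrow>
     (\<exists>g q w. idempotent_elem R g \<and> idempotent_elem R q \<and> nilpotent_elem R w \<and>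
        g \<otimes>\<^bsub>R\<^esub> q = \<zero>\<^bsub>R\<^esub> \<and> q \<otimes>\<^bsub>R\<^esub> g = \<zero>\<^bsub>R\<^esub> \<and> a = g \<ominus>\<^bsub>R\<^esub> q \<oplus>\<^bsub>R\<^esub> w)"

context ring
begin

lemma signed_nil_clean_imp_tripotent_plus_nilpotent:
  assumes "signed_nil_clean_elem R a"
  shows "\<exists>e b. tripotent_elem R e \<and> nilpotent_elem R b \<and> a = e \<oplus> b"
proof -
  obtain g q w where c: "g \<in> carrier R" "q \<in> carrier R" and i: "g \<otimes> g = g" "q \<otimes> q = q"
    and w: "nilpotent_elem R w" and o: "g \<otimes> q = \<zero>" "q \<otimes> g = \<zero>" and a: "a = g \<ominus> q \<oplus> w"
    using assms by (auto simp: signed_nil_clean_elem_def idempotent_elem_def)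
  have "(g \<ominus> q) \<otimes> (g \<ominus> q) = g \<oplus> q"
    using c i o by (simp add: minus_eq l_distr r_distr l_minus r_minus)
  moreover have "(g \<oplus> q) \<otimes> (g \<ominus> q) = g \<ominus> q"
    using c i o by (simp add: minus_eq l_distr r_distr l_minus r_minus)
  ultimately have "tripotent_elem R (g \<ominus> q)"
    using c by (simp add: tripotent_elem_def numeral_3_eq_3)
  then show ?thesis using w a by blast
qed

text \<open>
  The factor is the geometric sum \<open>1 + x + \<dots> + x\<^sup>n\<^sup>-\<^sup>1\<close>, which commutes with \<open>x\<close>.
\<close>

lemma one_minus_pow_factor:
  fixes n :: nat
  assumes x: "x \<in> carrier R"
  shows "\<exists>s\<in>carrier R. s \<otimes> x = x \<otimes> s \<and> \<one> \<ominus> x [^] n = (\<one> \<ominus> x) \<otimes> s"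
proof (induction n)
  case 0
  then show ?case using x by (intro bexI[of _ \<zero>]) (auto simp: minus_eq r_neg)
next
  case (Suc n)
  then obtain s where s: "s \<in> carrier R" "s \<otimes> x = x \<otimes> s" "\<one> \<ominus> x [^] n = (\<one> \<ominus> x) \<otimes> s" by blast
  have comm: "x \<otimes> x [^] n = x [^] n \<otimes> x" using x by (metis nat_pow_Suc nat_pow_Suc2)
  have "\<one> \<ominus> x [^] Suc n = (\<one> \<ominus> x [^] n) \<oplus> (x [^] n \<ominus> x [^] n \<otimes> x)"
  proof -
    have "\<one> \<oplus> (\<ominus> (x [^] n) \<oplus> (x [^] n \<oplus> \<ominus> (x [^] n \<otimes> x))) = \<one> \<oplus> \<ominus> (x [^] n \<otimes> x)"
      using x by (simp add: r_neg1)
    then show ?thesis using x by (simp add: minus_eq a_assoc)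
  qed
  also have "x [^] n \<ominus> x [^] n \<otimes> x = (\<one> \<ominus> x) \<otimes> x [^] n"
    using x by (simp add: minus_eq l_distr l_minus comm)
  also have "\<one> \<ominus> x [^] n \<oplus> (\<one> \<ominus> x) \<otimes> x [^] n = (\<one> \<ominus> x) \<otimes> (s \<oplus> x [^] n)"
    using x s(1) unfolding s(3) by (simp add: r_distr)
  finally show ?case using x s(1,2) comm
    by (intro bexI[of _ "s \<oplus> x [^] n"]) (auto simp: l_distr r_distr)
qed

lemma idempotent_pow:
  fixes n :: nat
  assumes "e \<in> carrier R" "e \<otimes> e = e" "n > 0"
  shows "e [^] n = e"
proof -
  have "e [^] Suc m = e" for m using assms(1,2) by (induction m) auto
  then show ?thesis using assms(3) by (cases n) auto
qed

lemma idempotent_one_minus: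
  assumes "e \<in> carrier R" "e \<otimes> e = e"
  shows "(\<one> \<ominus> e) \<otimes> (\<one> \<ominus> e) = \<one> \<ominus> e"
  using assms by (simp add: minus_eq l_distr r_distr l_minus r_minus r_neg1 r_neg l_neg)

lemma one_minus_one_minus:
  assumes "x \<in> carrier R"
  shows "\<one> \<ominus> (\<one> \<ominus> x) = x"
  using assms by (simp add: minus_eq minus_add r_neg1 r_neg2 a_assoc[symmetric] r_neg)

text \<open>
  Put \<open>u = x\<^sup>n\<close> and \<open>z = (1 - u)\<^sup>n\<close>. Then \<open>z\<close> is divisible by \<open>(1 - x)\<^sup>n\<close> and \<open>1 - z\<close> by \<open>x\<^sup>n\<close>, so
  \<open>(1 - z) z\<close> is divisible by \<open>(x - x\<^sup>2)\<^sup>n = 0\<close>. Divisibility of \<open>1 - z\<close> by \<open>x\<close> on both sides makes the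
  idempotent inherit orthogonality from \<open>x\<close>, and the closed formula makes it computable in a quotient.
\<close>

lemma idempotent_from_almost_idempotent:
  assumes x: "x \<in> carrier R" and nil: "nilpotent_elem R (x \<ominus> x \<otimes> x)"
  shows "\<exists>(n::nat) l r. n > 0 \<and> l \<in> carrier R \<and> r \<in> carrier R \<and>
    \<one> \<ominus> (\<one> \<ominus> x [^] n) [^] n = l \<otimes> x \<and> \<one> \<ominus> (\<one> \<ominus> x [^] n) [^] n = x \<otimes> r \<and>
    idempotent_elem R (\<one> \<ominus> (\<one> \<ominus> x [^] n) [^] n)"
proof -
  obtain n :: nat where n: "n > 0" "(x \<ominus> x \<otimes> x) [^] n = \<zero>"
    using nil by (auto simp: nilpotent_elem_def)
  define y where "y = \<one> \<ominus> x"
  define u where "u = x [^] n"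
  define z where "z = (\<one> \<ominus> u) [^] n"
  have c: "y \<in> carrier R" "u \<in> carrier R" "z \<in> carrier R" using x by (simp_all add: y_def u_def z_def)
  obtain s where s: "s \<in> carrier R" "s \<otimes> x = x \<otimes> s" "\<one> \<ominus> u = y \<otimes> s"
    using one_minus_pow_factor[OF x, of n] by (auto simp: u_def y_def)
  obtain t where t: "t \<in> carrier R" "t \<otimes> (\<one> \<ominus> u) = (\<one> \<ominus> u) \<otimes> t" "\<one> \<ominus> z = u \<otimes> t"
    using one_minus_pow_factor[of "\<one> \<ominus> u" n] c by (auto simp: z_def one_minus_one_minus)
  have ys: "y \<otimes> s = s \<otimes> y" using x s(1,2) by (simp add: y_def minus_eq l_distr r_distr l_minus r_minus)
  have xy: "x \<otimes> y = y \<otimes> x" "x \<otimes> y = x \<ominus> x \<otimes> x"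
    using x by (simp_all add: y_def minus_eq l_distr r_distr l_minus r_minus)
  have "u \<otimes> z = x [^] n \<otimes> y [^] n \<otimes> s [^] n"
    using x c s(1) pow_mult_distrib[OF ys c(1) s(1)] by (simp add: z_def u_def[symmetric] s(3) m_assoc)
  also have "x [^] n \<otimes> y [^] n = \<zero>"
    using pow_mult_distrib[OF xy(1) x c(1), of n] n(2) by (simp add: xy(2))
  finally have uz: "u \<otimes> z = \<zero>" using s(1) by simp
  have ut: "u \<otimes> t = t \<otimes> u"
  proof -
    have "t \<oplus> \<ominus> (t \<otimes> u) = t \<oplus> \<ominus> (u \<otimes> t)"
      using t(1,2) c by (simp add: minus_eq l_distr r_distr l_minus r_minus)
    then have "\<ominus> (t \<otimes> u) = \<ominus> (u \<otimes> t)" using t(1) c by simp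
    then show ?thesis using t(1) c by (metis minus_minus m_closed)
  qed
  have ez: "(\<one> \<ominus> z) \<otimes> z = \<zero>"
    unfolding t(3) ut using t(1) c uz by (simp add: m_assoc)
  have e: "idempotent_elem R (\<one> \<ominus> z)"
  proof -
    have "(\<one> \<ominus> z) \<otimes> (\<one> \<ominus> z) = (\<one> \<ominus> z) \<ominus> (\<one> \<ominus> z) \<otimes> z"
      using c by (simp add: minus_eq r_distr r_minus)
    then show ?thesis using ez c by (simp add: idempotent_elem_def minus_eq)
  qed
  obtain m where m: "n = Suc m" using n(1) by (cases n) auto
  have u: "u = x \<otimes> x [^] m" "u = x [^] m \<otimes> x"
    using x by (simp_all add: u_def m nat_pow_Suc2[symmetric] del: nat_pow_Suc)
  have "\<one> \<ominus> z = x \<otimes> (x [^] m \<otimes> t)" unfolding t(3) u(1) using x t(1) by (simp add: m_assoc)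
  moreover have "\<one> \<ominus> z = t \<otimes> x [^] m \<otimes> x" unfolding t(3) ut unfolding u(2) using x t(1) by (simp add: m_assoc)
  ultimately show ?thesis
    using n(1) e x t(1) unfolding z_def u_def by (metis m_closed nat_pow_closed)
qed

end

lemma (in ring_hom_ring) idempotent_lifts:
  assumes nil: "\<And>x. x \<in> carrier R \<Longrightarrow> h x = \<zero>\<^bsub>S\<^esub> \<Longrightarrow> nilpotent_elem R x"
    and x: "x \<in> carrier R" and hx: "idempotent_elem S (h x)"
  shows "\<exists>e l r. idempotent_elem R e \<and> h e = h x \<and> l \<in> carrier R \<and> r \<in> carrier R \<and>
    e = l \<otimes>\<^bsub>R\<^esub> x \<and> e = x \<otimes>\<^bsub>R\<^esub> r"
proof -
  have c: "h x \<in> carrier S" and i: "h x \<otimes>\<^bsub>S\<^esub> h x = h x" using hx by (auto simp: idempotent_elem_def)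
  have h_minus: "h (a \<ominus>\<^bsub>R\<^esub> b) = h a \<ominus>\<^bsub>S\<^esub> h b" if "a \<in> carrier R" "b \<in> carrier R" for a b
    using that by (simp add: R.minus_eq S.minus_eq)
  have "nilpotent_elem R (x \<ominus>\<^bsub>R\<^esub> x \<otimes>\<^bsub>R\<^esub> x)"
    using x c i by (intro nil) (simp_all add: h_minus S.minus_eq S.r_neg)
  then obtain n :: nat and l r where n: "n > 0" "l \<in> carrier R" "r \<in> carrier R"
    and e: "\<one>\<^bsub>R\<^esub> \<ominus>\<^bsub>R\<^esub> (\<one>\<^bsub>R\<^esub> \<ominus>\<^bsub>R\<^esub> x [^]\<^bsub>R\<^esub> n) [^]\<^bsub>R\<^esub> n = l \<otimes>\<^bsub>R\<^esub> x"
      "\<one>\<^bsub>R\<^esub> \<ominus>\<^bsub>R\<^esub> (\<one>\<^bsub>R\<^esub> \<ominus>\<^bsub>R\<^esub> x [^]\<^bsub>R\<^esub> n) [^]\<^bsub>R\<^esub> n = x \<otimes>\<^bsub>R\<^esub> r"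
      "idempotent_elem R (\<one>\<^bsub>R\<^esub> \<ominus>\<^bsub>R\<^esub> (\<one>\<^bsub>R\<^esub> \<ominus>\<^bsub>R\<^esub> x [^]\<^bsub>R\<^esub> n) [^]\<^bsub>R\<^esub> n)"
    using R.idempotent_from_almost_idempotent[OF x] by blast
  have "h (\<one>\<^bsub>R\<^esub> \<ominus>\<^bsub>R\<^esub> (\<one>\<^bsub>R\<^esub> \<ominus>\<^bsub>R\<^esub> x [^]\<^bsub>R\<^esub> n) [^]\<^bsub>R\<^esub> n)
      = \<one>\<^bsub>S\<^esub> \<ominus>\<^bsub>S\<^esub> (\<one>\<^bsub>S\<^esub> \<ominus>\<^bsub>S\<^esub> h x [^]\<^bsub>S\<^esub> n) [^]\<^bsub>S\<^esub> n"
    using x by (simp add: h_minus hom_nat_pow)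
  also have "\<dots> = h x"
    using c i n(1) by (simp add: S.idempotent_pow S.idempotent_one_minus S.one_minus_one_minus)
  finally show ?thesis using n(2,3) e by blast
qed

text \<open>
  The idempotents are lifted one after the other, the second inside the complement of the first; the
  remainder is nilpotent because a power of it lies in the nil kernel.
\<close>

theorem (in ring_hom_ring) signed_nil_clean_elem_lifts:
  assumes nil: "\<And>x. x \<in> carrier R \<Longrightarrow> h x = \<zero>\<^bsub>S\<^esub> \<Longrightarrow> nilpotent_elem R x"
    and surj: "h ` carrier R = carrier S"
    and a: "a \<in> carrier R" and ha: "signed_nil_clean_elem S (h a)"
  shows "signed_nil_clean_elem R a"
proof -
  have h_minus: "h (a \<ominus>\<^bsub>R\<^esub> b) = h a \<ominus>\<^bsub>S\<^esub> h b" if "a \<in> carrier R" "b \<in> carrier R" for a b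
    using that by (simp add: R.minus_eq S.minus_eq)
  obtain g' q' w' where g': "idempotent_elem S g'" and q': "idempotent_elem S q'"
    and w': "nilpotent_elem S w'" and orth: "g' \<otimes>\<^bsub>S\<^esub> q' = \<zero>\<^bsub>S\<^esub>" "q' \<otimes>\<^bsub>S\<^esub> g' = \<zero>\<^bsub>S\<^esub>"
    and ha_eq: "h a = g' \<ominus>\<^bsub>S\<^esub> q' \<oplus>\<^bsub>S\<^esub> w'"
    using ha by (auto simp: signed_nil_clean_elem_def)
  have c': "g' \<in> carrier S" "q' \<in> carrier S" "w' \<in> carrier S"
    using g' q' w' by (auto simp: idempotent_elem_def nilpotent_elem_def)
  obtain x where x: "x \<in> carrier R" "h x = g'" using surj c'(1) by (metis imageE)
  obtain g where g: "idempotent_elem R g" "h g = g'"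
    using idempotent_lifts[OF nil x(1)] g' x(2) by auto
  have gc: "g \<in> carrier R" "g \<otimes>\<^bsub>R\<^esub> g = g" using g by (auto simp: idempotent_elem_def)
  obtain y0 where y0: "y0 \<in> carrier R" "h y0 = q'" using surj c'(2) by (metis imageE)
  \<comment> \<open>Compressing a preimage of the second idempotent by \<open>1 - g\<close> makes it orthogonal to \<open>g\<close>.\<close>
  define f where "f = \<one>\<^bsub>R\<^esub> \<ominus>\<^bsub>R\<^esub> g"
  have f: "f \<in> carrier R" "g \<otimes>\<^bsub>R\<^esub> f = \<zero>\<^bsub>R\<^esub>" "f \<otimes>\<^bsub>R\<^esub> g = \<zero>\<^bsub>R\<^esub>"
    using gc by (simp_all add: f_def R.minus_eq R.l_distr R.r_distr R.l_minus R.r_minus R.r_neg)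
  define y where "y = f \<otimes>\<^bsub>R\<^esub> y0 \<otimes>\<^bsub>R\<^esub> f"
  have y: "y \<in> carrier R" "g \<otimes>\<^bsub>R\<^esub> y = \<zero>\<^bsub>R\<^esub>" "y \<otimes>\<^bsub>R\<^esub> g = \<zero>\<^bsub>R\<^esub>"
  proof -
    show "y \<in> carrier R" using f y0 by (simp add: y_def)
    have "g \<otimes>\<^bsub>R\<^esub> y = g \<otimes>\<^bsub>R\<^esub> f \<otimes>\<^bsub>R\<^esub> (y0 \<otimes>\<^bsub>R\<^esub> f)"
      using f(1) y0 gc by (simp add: y_def R.m_assoc)
    then show "g \<otimes>\<^bsub>R\<^esub> y = \<zero>\<^bsub>R\<^esub>" using f y0 by simp
    have "y \<otimes>\<^bsub>R\<^esub> g = f \<otimes>\<^bsub>R\<^esub> y0 \<otimes>\<^bsub>R\<^esub> (f \<otimes>\<^bsub>R\<^esub> g)"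
      using f(1) y0 gc by (simp add: y_def R.m_assoc)
    then show "y \<otimes>\<^bsub>R\<^esub> g = \<zero>\<^bsub>R\<^esub>" using f y0 by simp
  qed
  have "h y = (\<one>\<^bsub>S\<^esub> \<ominus>\<^bsub>S\<^esub> g') \<otimes>\<^bsub>S\<^esub> q' \<otimes>\<^bsub>S\<^esub> (\<one>\<^bsub>S\<^esub> \<ominus>\<^bsub>S\<^esub> g')"
    using f(1) y0 gc g(2) by (simp add: y_def h_minus f_def)
  also have "\<dots> = q'"
    using c' orth by (simp add: S.minus_eq S.l_distr S.r_distr S.l_minus S.r_minus)
  finally have hy: "h y = q'" .
  obtain q l r where q: "idempotent_elem R q" "h q = q'" "l \<in> carrier R" "r \<in> carrier R"
    "q = l \<otimes>\<^bsub>R\<^esub> y" "q = y \<otimes>\<^bsub>R\<^esub> r"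
    using idempotent_lifts[OF nil y(1)] q' hy by metis
  have qc: "q \<in> carrier R" using q(1) by (simp add: idempotent_elem_def)
  have gq: "g \<otimes>\<^bsub>R\<^esub> q = \<zero>\<^bsub>R\<^esub>"
    unfolding q(6) using gc y q(4) by (simp add: R.m_assoc[symmetric])
  have qg: "q \<otimes>\<^bsub>R\<^esub> g = \<zero>\<^bsub>R\<^esub>"
    unfolding q(5) using gc y q(3) by (simp add: R.m_assoc)
  define w where "w = a \<ominus>\<^bsub>R\<^esub> (g \<ominus>\<^bsub>R\<^esub> q)"
  have wc: "w \<in> carrier R" using a gc qc by (simp add: w_def)
  have "d \<oplus>\<^bsub>S\<^esub> w' \<ominus>\<^bsub>S\<^esub> d = w'" if "d \<in> carrier S" for d
    using that c' by (simp add: S.minus_eq S.a_comm[of d w'] S.a_assoc S.r_neg)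
  then have "h w = w'"
    using a gc qc c' by (simp add: w_def h_minus g(2) q(2) ha_eq)
  obtain k :: nat where k: "k > 0" "w' [^]\<^bsub>S\<^esub> k = \<zero>\<^bsub>S\<^esub>" using w' by (auto simp: nilpotent_elem_def)
  then have "h (w [^]\<^bsub>R\<^esub> k) = \<zero>\<^bsub>S\<^esub>" using wc \<open>h w = w'\<close> by (simp add: hom_nat_pow)
  then have "nilpotent_elem R (w [^]\<^bsub>R\<^esub> k)" using nil wc by simp
  then obtain m :: nat where "m > 0" "(w [^]\<^bsub>R\<^esub> k) [^]\<^bsub>R\<^esub> m = \<zero>\<^bsub>R\<^esub>" by (auto simp: nilpotent_elem_def)
  then have "nilpotent_elem R w"
    using k(1) wc by (auto simp: nilpotent_elem_def R.nat_pow_pow intro!: exI[of _ "k * m"])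
  moreover have "a = g \<ominus>\<^bsub>R\<^esub> q \<oplus>\<^bsub>R\<^esub> w"
    using a gc qc by (simp add: w_def R.minus_eq R.a_ac R.r_neg R.minus_add R.r_neg1 R.r_neg2)
  ultimately show ?thesis using g(1) q(1) gq qg unfolding signed_nil_clean_elem_def by blast
qed

context ring
begin

text \<open>
  A central idempotent splits the ring into a product, and decompositions of the two components can be
  combined. The map \<open>mix\<close> below is the ring homomorphism that glues the components.
\<close>

lemma signed_nil_clean_elem_split:
  assumes \<epsilon>: "\<epsilon> \<in> carrier R" "\<epsilon> \<otimes> \<epsilon> = \<epsilon>" and central: "\<And>x. x \<in> carrier R \<Longrightarrow> x \<otimes> \<epsilon> = \<epsilon> \<otimes> x"
    and a: "a \<in> carrier R"
    and D: "signed_nil_clean_elem R (\<epsilon> \<otimes> a)" "signed_nil_clean_elem R ((\<one> \<ominus> \<epsilon>) \<otimes> a)"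
  shows "signed_nil_clean_elem R a"
proof -
  define \<delta> where "\<delta> = \<one> \<ominus> \<epsilon>"
  have \<delta>: "\<delta> \<in> carrier R" "\<delta> \<otimes> \<delta> = \<delta>" "\<epsilon> \<otimes> \<delta> = \<zero>" "\<delta> \<otimes> \<epsilon> = \<zero>"
    using \<epsilon> idempotent_one_minus[OF \<epsilon>]
    by (simp_all add: \<delta>_def minus_eq l_distr r_distr l_minus r_minus r_neg)
  have sum_one: "\<epsilon> \<oplus> \<delta> = \<one>"
    using \<epsilon>(1) by (simp add: \<delta>_def minus_eq a_lcomm[of \<epsilon> \<one>] r_neg)
  have central': "x \<otimes> \<delta> = \<delta> \<otimes> x" if "x \<in> carrier R" for x
    using that \<epsilon> central[OF that] by (simp add: \<delta>_def minus_eq l_distr r_distr l_minus r_minus)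
  define mix where "mix x y = \<epsilon> \<otimes> x \<oplus> \<delta> \<otimes> y" for x y
  have mix_closed: "mix x y \<in> carrier R" if "x \<in> carrier R" "y \<in> carrier R" for x y
    using that \<epsilon> \<delta> by (simp add: mix_def)
  have mult: "\<alpha> \<otimes> x \<otimes> (\<beta> \<otimes> y) = (\<alpha> \<otimes> \<beta>) \<otimes> (x \<otimes> y)"
    if "x \<otimes> \<beta> = \<beta> \<otimes> x" "\<alpha> \<in> carrier R" "\<beta> \<in> carrier R" "x \<in> carrier R" "y \<in> carrier R" for \<alpha> \<beta> x y
  proof -
    have "\<alpha> \<otimes> x \<otimes> (\<beta> \<otimes> y) = \<alpha> \<otimes> (x \<otimes> \<beta>) \<otimes> y" using that(2-) by (simp add: m_assoc)
    then show ?thesis unfolding that(1) using that(2-) by (simp add: m_assoc)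
  qed
  have mix_mult: "mix x y \<otimes> mix x' y' = mix (x \<otimes> x') (y \<otimes> y')"
    if "x \<in> carrier R" "y \<in> carrier R" "x' \<in> carrier R" "y' \<in> carrier R" for x y x' y'
  proof -
    have "\<epsilon> \<otimes> x \<otimes> (\<epsilon> \<otimes> x') = \<epsilon> \<otimes> (x \<otimes> x')" "\<epsilon> \<otimes> x \<otimes> (\<delta> \<otimes> y') = \<zero>"
      "\<delta> \<otimes> y \<otimes> (\<epsilon> \<otimes> x') = \<zero>" "\<delta> \<otimes> y \<otimes> (\<delta> \<otimes> y') = \<delta> \<otimes> (y \<otimes> y')"
      using that \<epsilon>(1) \<delta>(1) unfolding mult[OF central[OF that(1)] \<epsilon>(1) \<epsilon>(1) that(1,3)]
        mult[OF central'[OF that(1)] \<epsilon>(1) \<delta>(1) that(1,4)] mult[OF central[OF that(2)] \<delta>(1) \<epsilon>(1) that(2,3)]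
        mult[OF central'[OF that(2)] \<delta>(1) \<delta>(1) that(2,4)] \<epsilon>(2) \<delta>(2-4) by simp_all
    then show ?thesis using that \<epsilon>(1) \<delta>(1) by (simp add: mix_def l_distr r_distr)
  qed
  have mix_add: "mix x y \<oplus> mix x' y' = mix (x \<oplus> x') (y \<oplus> y')"
    if "x \<in> carrier R" "y \<in> carrier R" "x' \<in> carrier R" "y' \<in> carrier R" for x y x' y'
    using that \<epsilon> \<delta> by (simp add: mix_def r_distr a_ac)
  have mix_minus: "\<ominus> mix x y = mix (\<ominus> x) (\<ominus> y)"
    if "x \<in> carrier R" "y \<in> carrier R" for x y
    using that \<epsilon> \<delta> by (simp add: mix_def r_minus minus_add)
  have mix_same: "mix x x = x" if "x \<in> carrier R" for x
    using that \<epsilon> \<delta> by (simp add: mix_def l_distr[symmetric] sum_one)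
  have mix_pow: "mix x y [^] (k::nat) = mix (x [^] k) (y [^] k)"
    if "x \<in> carrier R" "y \<in> carrier R" for x y k
    using that by (induction k) (simp_all add: mix_same mix_mult)
  obtain g1 q1 w1 g2 q2 w2 where
    1: "idempotent_elem R g1" "idempotent_elem R q1" "nilpotent_elem R w1"
      "g1 \<otimes> q1 = \<zero>" "q1 \<otimes> g1 = \<zero>" "\<epsilon> \<otimes> a = g1 \<ominus> q1 \<oplus> w1" and
    2: "idempotent_elem R g2" "idempotent_elem R q2" "nilpotent_elem R w2"
      "g2 \<otimes> q2 = \<zero>" "q2 \<otimes> g2 = \<zero>" "\<delta> \<otimes> a = g2 \<ominus> q2 \<oplus> w2"
    using D by (auto simp: signed_nil_clean_elem_def \<delta>_def)
  have c: "g1 \<in> carrier R" "q1 \<in> carrier R" "w1 \<in> carrier R" "g2 \<in> carrier R" "q2 \<in> carrier R" "w2 \<in> carrier R"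
    using 1 2 by (auto simp: idempotent_elem_def nilpotent_elem_def)
  have idem: "idempotent_elem R (mix g1 g2)" "idempotent_elem R (mix q1 q2)"
    using 1 2 c by (simp_all add: idempotent_elem_def mix_mult mix_closed)
  have orth: "mix g1 g2 \<otimes> mix q1 q2 = \<zero>" "mix q1 q2 \<otimes> mix g1 g2 = \<zero>"
    using 1 2 c by (simp_all add: mix_mult mix_same)
  obtain k l :: nat where kl: "k > 0" "w1 [^] k = \<zero>" "w2 [^] l = \<zero>"
    using 1 2 by (auto simp: nilpotent_elem_def)
  have "mix w1 w2 [^] (k + l) = mix (w1 [^] k \<otimes> w1 [^] l) (w2 [^] k \<otimes> w2 [^] l)"
    using c by (simp add: mix_pow nat_pow_mult)
  also have "\<dots> = \<zero>" using c kl by (simp add: mix_same)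
  finally have nil: "nilpotent_elem R (mix w1 w2)"
    using kl(1) c by (auto simp: nilpotent_elem_def mix_closed intro!: exI[of _ "k + l"])
  have "mix g1 g2 \<ominus> mix q1 q2 \<oplus> mix w1 w2 = mix (\<epsilon> \<otimes> a) (\<delta> \<otimes> a)"
    unfolding 1(6) 2(6) using c by (simp add: minus_eq mix_minus mix_add)
  also have "\<dots> = a"
    using \<epsilon> \<delta> a by (simp add: mix_def m_assoc[symmetric] l_distr[symmetric] sum_one)
  finally show ?thesis using idem orth nil unfolding signed_nil_clean_elem_def by metis
qed

end

section \<open>Matrices over the two- and three-element fields\<close>

text \<open>
  The size \<open>n\<close> of the matrices is a variable, so column vectors are modelled by functions on the natural
  numbers that vanish from \<open>n\<close> on.
\<close>

definition fun_scale :: "'k::field \<Rightarrow> (nat \<Rightarrow> 'k) \<Rightarrow> nat \<Rightarrow> 'k" where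
  "fun_scale c f = (\<lambda>i. c * f i)"

definition unit_fun :: "nat \<Rightarrow> nat \<Rightarrow> 'k::field" where
  "unit_fun j = (\<lambda>i. if i = j then 1 else 0)"

definition mat_fun :: "nat \<Rightarrow> (nat \<Rightarrow> nat \<Rightarrow> 'k::field) \<Rightarrow> (nat \<Rightarrow> 'k) \<Rightarrow> nat \<Rightarrow> 'k" where
  "mat_fun n B f = (\<lambda>i. if i < n then \<Sum>j<n. B i j * f j else 0)"

lemma linear_operator_mat_fun: "linear_operator fun_scale (mat_fun n B)"
  by unfold_locales
    (auto simp: fun_scale_def mat_fun_def fun_eq_iff algebra_simps sum.distrib sum_distrib_left)

lemma sum_apply: "(\<Sum>j<n. F j) i = (\<Sum>j<n. F j i)" for n :: nat
  by (induction n) simp_all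

lemma mat_fun_unit_fun: "i < n \<Longrightarrow> j < n \<Longrightarrow> mat_fun n B (unit_fun j) i = B i j"
  by (simp add: mat_fun_def unit_fun_def if_distrib cong: if_cong)

lemma fun_expand:
  assumes "\<And>i. i \<ge> n \<Longrightarrow> f i = 0"
  shows "f = (\<Sum>j<n. fun_scale (f j) (unit_fun j))"
proof
  fix i
  have "(\<Sum>j<n. fun_scale (f j) (unit_fun j)) i = (\<Sum>j<n. f j * (if i = j then 1 else 0))"
    by (simp add: sum_apply fun_scale_def unit_fun_def)
  also have "\<dots> = (if i < n then f i else 0)" by (simp add: if_distrib cong: if_cong)
  finally show "f i = (\<Sum>j<n. fun_scale (f j) (unit_fun j)) i" using assms[of i] by (cases "i < n") simp_all
qed


text \<open>
  In the application \<open>\<phi>\<close> sends a prime field onto the multiples of an idempotent \<open>e\<close>, so it respects sums and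
  products without being unital. Applied to the entries, it turns operators on functions supported below
  \<open>n\<close> into matrices over \<open>R\<close>, compatibly with sums and compositions.
\<close>

theorem (in ring) signed_nil_clean_elem_of_field_matrix:
  fixes \<phi> :: "'k::field \<Rightarrow> 'a" and B :: "nat \<Rightarrow> nat \<Rightarrow> 'k"
  assumes closed: "\<And>x. \<phi> x \<in> carrier R"
    and add: "\<And>x y. \<phi> (x + y) = \<phi> x \<oplus> \<phi> y" and mult: "\<And>x y. \<phi> (x * y) = \<phi> x \<otimes> \<phi> y"
    and field: "(\<forall>c::'k. c = 0 \<or> c = 1) \<or> (1::'k) + 1 + 1 = 0 \<and> (\<forall>c::'k. c = 0 \<or> c = 1 \<or> c = - 1)"
  shows "signed_nil_clean_elem (matrix_ring n R) (mat n n (\<lambda>(i, j). \<phi> (B i j)))"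
proof -
  let ?M = "matrix_ring n R"
  interpret M: ring ?M by (rule ring_matrix_ring)
  define T where "T = mat_fun n B"
  interpret L: linear_operator fun_scale T unfolding T_def by (rule linear_operator_mat_fun)
  interpret endo: vector_space_pair "fun_scale :: 'k \<Rightarrow> _" fun_scale ..
  define C :: "(nat \<Rightarrow> 'k) set" where "C = unit_fun ` {..<n}"
  have finite_C: "finite C" by (simp add: C_def)
  have C_mem: "unit_fun j \<in> L.span C" if "j < n" for j
    using that by (intro L.span_base) (simp add: C_def)
  have supported: "f i = 0" if "f \<in> L.span C" "i \<ge> n" for f i
  proof -
    have "L.subspace {f. f i = 0}" by (rule L.subspaceI) (simp_all add: fun_scale_def)
    moreover have "C \<subseteq> {f. f i = 0}" using that(2) by (auto simp: C_def unit_fun_def)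
    ultimately have "L.span C \<subseteq> {f. f i = 0}" by (intro L.span_minimal)
    then show ?thesis using that(1) by blast
  qed
  have span_C: "f \<in> L.span C" if "\<And>i. i \<ge> n \<Longrightarrow> f i = 0" for f
    using C_mem by (subst fun_expand[OF that]) (auto intro!: L.span_sum L.span_scale)
  have TC: "T ` L.span C \<subseteq> L.span C" by (auto intro!: span_C simp: T_def mat_fun_def)
  obtain G Q W k where lin: "L.lin G" "L.lin Q" "L.lin W"
    and stable: "G ` L.span C \<subseteq> L.span C" "Q ` L.span C \<subseteq> L.span C" "W ` L.span C \<subseteq> L.span C"
    and GG: "\<And>x. x \<in> L.span C \<Longrightarrow> G (G x) = G x" and QQ: "\<And>x. x \<in> L.span C \<Longrightarrow> Q (Q x) = Q x"
    and GQ: "\<And>x. x \<in> L.span C \<Longrightarrow> G (Q x) = 0" and QG: "\<And>x. x \<in> L.span C \<Longrightarrow> Q (G x) = 0"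
    and TQ: "\<And>x. x \<in> L.span C \<Longrightarrow> T x + Q x = G x + W x" and W: "\<And>x. x \<in> L.span C \<Longrightarrow> (W ^^ k) x = 0"
    by (rule L.signed_idempotents_plus_nilpotent[OF TC finite_C field]) (rule that; assumption)
  have \<phi>0: "\<phi> 0 = \<zero>" using add[of 0 0] closed[of 0] by simp
  have \<phi>_sum: "\<phi> (\<Sum>j<m. f j) = (\<Oplus>j\<in>{..<m}. \<phi> (f j))" for f and m :: nat
  proof (induction m)
    case (Suc m)
    have "(\<Oplus>j\<in>insert m {..<m}. \<phi> (f j)) = \<phi> (f m) \<oplus> (\<Oplus>j\<in>{..<m}. \<phi> (f j))"
      using closed by (intro finsum_insert) auto
    then show ?case using Suc closed by (simp add: add a_comm lessThan_Suc)
  qed (simp add: \<phi>0)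
  define \<Phi> where "\<Phi> F = mat n n (\<lambda>(i, j). \<phi> (F (unit_fun j) i))"
    for F :: "(nat \<Rightarrow> 'k) \<Rightarrow> nat \<Rightarrow> 'k"
  have \<Phi>_closed: "\<Phi> F \<in> carrier ?M" for F using closed by (simp add: \<Phi>_def matrix_ring_def)
  have \<Phi>_cong: "\<Phi> F = \<Phi> F'" if "\<And>x. x \<in> L.span C \<Longrightarrow> F x = F' x" for F F'
    using that C_mem by (auto simp: \<Phi>_def intro!: eq_matI)
  have \<Phi>_add: "\<Phi> (\<lambda>x. F x + F' x) = \<Phi> F \<oplus>\<^bsub>?M\<^esub> \<Phi> F'" for F F'
    by (auto simp: \<Phi>_def matrix_ring_def add intro!: eq_matI)
  have \<Phi>_zero: "\<Phi> (\<lambda>x. 0) = \<zero>\<^bsub>?M\<^esub>" by (auto simp: \<Phi>_def matrix_ring_def \<phi>0 intro!: eq_matI)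
  have \<Phi>_mult: "\<Phi> (\<lambda>x. F (F' x)) = \<Phi> F \<otimes>\<^bsub>?M\<^esub> \<Phi> F'"
    if F: "L.lin F" and F': "F' ` L.span C \<subseteq> L.span C" for F F'
  proof -
    have "F (F' (unit_fun j)) i = (\<Sum>k<n. F (unit_fun k) i * F' (unit_fun j) k)" if "j < n" for i j
    proof -
      have "F' (unit_fun j) \<in> L.span C" using F' C_mem[OF that] by blast
      then have "F' (unit_fun j) = (\<Sum>k<n. fun_scale (F' (unit_fun j) k) (unit_fun k))"
        using supported by (intro fun_expand) blast
      then have "F (F' (unit_fun j)) = F (\<Sum>k<n. fun_scale (F' (unit_fun j) k) (unit_fun k))" by simp
      also have "\<dots> = (\<Sum>k<n. fun_scale (F' (unit_fun j) k) (F (unit_fun k)))"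
        by (simp add: endo.linear_sum[OF F] endo.linear_scale[OF F])
      finally show ?thesis by (simp add: sum_apply fun_scale_def mult.commute)
    qed
    then show ?thesis using closed
      by (auto simp: \<Phi>_def matrix_ring_def \<phi>_sum mult intro!: eq_matI finsum_cong')
  qed
  \<comment> \<open>The exponent starts at 1 because \<open>\<Phi>\<close> does not preserve the identity.\<close>
  have pow: "\<Phi> W [^]\<^bsub>?M\<^esub> Suc m = \<Phi> (W ^^ Suc m)" for m
  proof (induction m)
    case 0
    then show ?case using \<Phi>_closed[of W] by simp
  next
    case (Suc m)
    have "\<Phi> W [^]\<^bsub>?M\<^esub> Suc (Suc m) = \<Phi> W \<otimes>\<^bsub>?M\<^esub> \<Phi> W [^]\<^bsub>?M\<^esub> Suc m"
      by (rule M.nat_pow_Suc2[OF \<Phi>_closed])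
    also have "\<dots> = \<Phi> (\<lambda>x. W ((W ^^ Suc m) x))"
    proof -
      have "(W ^^ Suc m) ` L.span C \<subseteq> L.span C" using stable(3) by (induction m) auto
      from \<Phi>_mult[OF lin(3) this, symmetric] show ?thesis unfolding Suc .
    qed
    finally show ?case by (simp add: o_def)
  qed
  have "\<Phi> (W ^^ Suc k) = \<Phi> (\<lambda>x. 0)"
    using W endo.linear_0[OF lin(3)] by (intro \<Phi>_cong) simp
  then have nil: "nilpotent_elem ?M (\<Phi> W)"
    unfolding nilpotent_elem_def using \<Phi>_closed \<Phi>_zero pow[of k] by (metis zero_less_Suc)
  have idem: "idempotent_elem ?M (\<Phi> G)" "idempotent_elem ?M (\<Phi> Q)"
    using \<Phi>_mult[OF lin(1) stable(1)] \<Phi>_cong[of "\<lambda>x. G (G x)" G, OF GG]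
      \<Phi>_mult[OF lin(2) stable(2)] \<Phi>_cong[of "\<lambda>x. Q (Q x)" Q, OF QQ] \<Phi>_closed
    by (simp_all add: idempotent_elem_def)
  have orth: "\<Phi> G \<otimes>\<^bsub>?M\<^esub> \<Phi> Q = \<zero>\<^bsub>?M\<^esub>" "\<Phi> Q \<otimes>\<^bsub>?M\<^esub> \<Phi> G = \<zero>\<^bsub>?M\<^esub>"
    using \<Phi>_mult[OF lin(1) stable(2)] \<Phi>_cong[of "\<lambda>x. G (Q x)" "\<lambda>x. 0", OF GQ]
      \<Phi>_mult[OF lin(2) stable(1)] \<Phi>_cong[of "\<lambda>x. Q (G x)" "\<lambda>x. 0", OF QG] \<Phi>_zero
    by simp_all
  have "\<Phi> T \<oplus>\<^bsub>?M\<^esub> \<Phi> Q = \<Phi> G \<oplus>\<^bsub>?M\<^esub> \<Phi> W"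
    using \<Phi>_cong[of "\<lambda>x. T x + Q x" "\<lambda>x. G x + W x", OF TQ] by (simp only: \<Phi>_add)
  then have "\<Phi> T \<oplus>\<^bsub>?M\<^esub> \<Phi> Q \<ominus>\<^bsub>?M\<^esub> \<Phi> Q = \<Phi> G \<oplus>\<^bsub>?M\<^esub> \<Phi> W \<ominus>\<^bsub>?M\<^esub> \<Phi> Q" by simp
  then have "\<Phi> T = \<Phi> G \<ominus>\<^bsub>?M\<^esub> \<Phi> Q \<oplus>\<^bsub>?M\<^esub> \<Phi> W"
    using \<Phi>_closed by (simp add: M.minus_eq M.a_assoc M.r_neg M.a_comm[of "\<Phi> W"])
  moreover have "\<Phi> T = mat n n (\<lambda>(i, j). \<phi> (B i j))"
    by (auto simp: \<Phi>_def T_def mat_fun_unit_fun intro!: eq_matI)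
  ultimately show ?thesis using idem nil orth unfolding signed_nil_clean_elem_def by metis
qed

section \<open>Rings in which every element is tripotent\<close>

lemma finite_2_cases: "(x :: Enum.finite_2) = 0 \<or> x = 1"
  by (cases x) simp_all

lemma finite_3_cases: "(x :: Enum.finite_3) = 0 \<or> x = 1 \<or> x = - 1"
  by (cases x) (simp_all add: uminus_finite_3_def)

lemma finite_3_char: "(1 :: Enum.finite_3) + 1 + 1 = 0"
  by (simp add: plus_finite_3_def)

locale tripotent_ring = ring +
  assumes tripotent: "x \<in> carrier R \<Longrightarrow> x \<otimes> x \<otimes> x = x"
begin

lemma square_zero_imp_zero:
  assumes "x \<in> carrier R" "x \<otimes> x = \<zero>"
  shows "x = \<zero>"
  using tripotent[OF assms(1)] assms by simp

text \<open>
  Both off-diagonal Peirce components \<open>e x (1 - e)\<close> and \<open>(1 - e) x e\<close> have square zero.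
\<close>

lemma idempotent_central:
  assumes e: "e \<in> carrier R" "e \<otimes> e = e" and x: "x \<in> carrier R"
  shows "x \<otimes> e = e \<otimes> x"
proof -
  define f where "f = \<one> \<ominus> e"
  have f: "f \<in> carrier R" "e \<otimes> f = \<zero>" "f \<otimes> e = \<zero>"
    using e by (simp_all add: f_def minus_eq l_distr r_distr l_minus r_minus r_neg)
  have "e \<otimes> x \<otimes> f = \<zero>"
  proof (rule square_zero_imp_zero)
    have "e \<otimes> x \<otimes> f \<otimes> (e \<otimes> x \<otimes> f) = e \<otimes> x \<otimes> (f \<otimes> e) \<otimes> (x \<otimes> f)"
      using e(1) f(1) x by (simp add: m_assoc)
    then show "e \<otimes> x \<otimes> f \<otimes> (e \<otimes> x \<otimes> f) = \<zero>" using e(1) f x by simp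
  qed (use e f x in simp)
  moreover have "f \<otimes> x \<otimes> e = \<zero>"
  proof (rule square_zero_imp_zero)
    have "f \<otimes> x \<otimes> e \<otimes> (f \<otimes> x \<otimes> e) = f \<otimes> x \<otimes> (e \<otimes> f) \<otimes> (x \<otimes> e)"
      using e(1) f(1) x by (simp add: m_assoc)
    then show "f \<otimes> x \<otimes> e \<otimes> (f \<otimes> x \<otimes> e) = \<zero>" using e(1) f x by simp
  qed (use e f x in simp)
  moreover have "e \<otimes> x \<otimes> f = e \<otimes> x \<ominus> e \<otimes> x \<otimes> e" "f \<otimes> x \<otimes> e = x \<otimes> e \<ominus> e \<otimes> x \<otimes> e"
    using e(1) x by (simp_all add: f_def minus_eq l_distr r_distr l_minus r_minus)
  ultimately show ?thesis using e(1) x by (metis m_closed r_right_minus_eq)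
qed

text \<open>
  This is \<open>2\<^sup>3 = 2\<close>.
\<close>

lemma six_eq_zero: "\<one> \<oplus> (\<one> \<oplus> (\<one> \<oplus> (\<one> \<oplus> (\<one> \<oplus> \<one>)))) = \<zero>"
proof -
  have "(\<one> \<oplus> \<one>) \<oplus> (\<one> \<oplus> (\<one> \<oplus> (\<one> \<oplus> (\<one> \<oplus> (\<one> \<oplus> \<one>))))) = (\<one> \<oplus> \<one>) \<oplus> \<zero>"
    using tripotent[of "\<one> \<oplus> \<one>"] by (simp add: l_distr r_distr a_assoc)
  then show ?thesis by (simp only: add.l_cancel a_closed one_closed zero_closed)
qed

abbreviation idem :: "'a \<Rightarrow> bool" where
  "idem e \<equiv> e \<in> carrier R \<and> e \<otimes> e = e"

text \<open>
  These two notions refer to the component of the ring cut out by the idempotent \<open>e\<close>, whose identity is \<open>e\<close>: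
  its characteristic divides \<open>2\<close> or \<open>3\<close>, and in the second notion \<open>x\<close> becomes one of \<open>0\<close>, \<open>1\<close>, \<open>-1\<close> there.
\<close>

definition small_char :: "'a \<Rightarrow> bool" where
  "small_char e \<longleftrightarrow> e \<oplus> e = \<zero> \<or> e \<oplus> e \<oplus> e = \<zero>"

definition constant_on :: "'a \<Rightarrow> 'a \<Rightarrow> bool" where
  "constant_on e x \<longleftrightarrow> e \<otimes> x \<in> {\<zero>, e, \<ominus> e}"

lemma small_char_refine:
  assumes "small_char e" "e \<in> carrier R" "p \<in> carrier R" "p \<otimes> e = p"
  shows "small_char p"
proof -
  have "p \<oplus> p = p \<otimes> (e \<oplus> e)" "p \<oplus> p \<oplus> p = p \<otimes> (e \<oplus> e \<oplus> e)"
    using assms(2-4) by (simp_all add: r_distr)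
  then show ?thesis using assms(1,3) by (auto simp: small_char_def)
qed

lemma constant_on_refine:
  assumes "constant_on e x" "e \<in> carrier R" "x \<in> carrier R" "p \<in> carrier R" "p \<otimes> e = p"
  shows "constant_on p x"
proof -
  have "p \<otimes> x = p \<otimes> (e \<otimes> x)" using assms(2-5) by (simp add: m_assoc[symmetric])
  then show ?thesis using assms by (auto simp: constant_on_def r_minus)
qed

text \<open>
  The finitely many elements of \<open>X\<close> are made constant one after the other. An element \<open>y\<close> with
  component \<open>a = e y\<close> vanishes on \<open>e - z\<close>, where \<open>z = a\<^sup>2\<close>, and squares to the identity on \<open>z\<close>. There it is the identity
  in characteristic 2; in characteristic 3 it is \<open>1\<close> on \<open>g = -(z + a)\<close> and \<open>-1\<close> on \<open>z - g\<close>.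
\<close>

lemma idempotent_split_induct:
  assumes X: "finite X" "X \<subseteq> carrier R"
    and split: "\<And>e p. idem e \<Longrightarrow> idem p \<Longrightarrow> p \<otimes> e = p \<Longrightarrow> P p \<Longrightarrow> P (e \<ominus> p) \<Longrightarrow> P e"
    and base: "\<And>e. idem e \<Longrightarrow> small_char e \<Longrightarrow> (\<And>x. x \<in> X \<Longrightarrow> constant_on e x) \<Longrightarrow> P e"
  shows "P \<one>"
proof -
  have diff: "idem (e \<ominus> p) \<and> (e \<ominus> p) \<otimes> e = e \<ominus> p" if "idem e" "idem p" "p \<otimes> e = p" for e p
    using that idempotent_central[of e p]
    by (simp add: minus_eq l_distr r_distr l_minus r_minus r_neg)
  have small: "P e" if "finite Y" "Y \<subseteq> X" "idem e" "small_char e" "\<And>x. x \<in> X - Y \<Longrightarrow> constant_on e x" for Y e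
    using that
  proof (induction Y arbitrary: e)
    case empty
    then show ?case using base by simp
  next
    case (insert y Y)
    have y: "y \<in> carrier R" using insert.prems X by auto
    have e: "e \<in> carrier R" "e \<otimes> e = e" using insert.prems by auto
    have piece: "P p" if p: "idem p" "p \<otimes> e = p" "constant_on p y" for p
    proof (rule insert.IH)
      show "small_char p" using small_char_refine insert.prems(3) e(1) p by blast
      show "constant_on p x" if "x \<in> X - Y" for x
        using that p constant_on_refine[OF insert.prems(4)[of x] e(1), of p] X by (cases "x = y") auto
    qed (use insert.prems p in auto)
    define a where "a = e \<otimes> y"
    define z where "z = a \<otimes> a"
    have a: "a \<in> carrier R" "e \<otimes> a = a" "a \<otimes> e = a"
      using e y idempotent_central[OF e y] by (simp_all add: a_def m_assoc) (simp_all add: m_assoc[symmetric])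
    have a3: "a \<otimes> a \<otimes> a = a" by (rule tripotent[OF a(1)])
    have z: "z \<in> carrier R" "z \<otimes> a = a" "a \<otimes> z = a" "z \<otimes> z = z" "z \<otimes> e = z" "e \<otimes> z = z"
      using a a3 e by (simp_all add: z_def m_assoc) (simp add: m_assoc[symmetric])
    have act: "b \<otimes> y = b \<otimes> a" if "b \<in> carrier R" "b \<otimes> e = b" for b
      using that e y by (simp add: a_def m_assoc[symmetric])
    have "P (e \<ominus> z)"
    proof (rule piece)
      have "(e \<ominus> z) \<otimes> y = (e \<ominus> z) \<otimes> a" using diff[of e z] z e by (intro act) auto
      also have "\<dots> = \<zero>" using a z e by (simp add: minus_eq l_distr l_minus r_neg)
      finally show "constant_on (e \<ominus> z) y" by (simp add: constant_on_def)
    qed (use diff[of e z] z e in auto)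
    moreover have "P z"
    proof (cases "e \<oplus> e = \<zero>")
      case True
      have "a \<oplus> a = (e \<oplus> e) \<otimes> a" using e a by (simp add: l_distr)
      then have aa: "a \<oplus> a = \<zero>" using True a by simp
      \<comment> \<open>The tripotency of \<open>e + a\<close> forces \<open>z = a\<close>.\<close>
      have "(e \<oplus> a) \<otimes> (e \<oplus> a) = e \<oplus> z"
      proof -
        have "(e \<oplus> a) \<otimes> (e \<oplus> a) = e \<oplus> (a \<oplus> a \<oplus> z)" using e a by (simp add: l_distr r_distr z_def a_assoc)
        then show ?thesis using aa z by simp
      qed
      moreover have "(e \<oplus> z) \<otimes> (e \<oplus> a) = e \<oplus> z"
      proof -
        have "(e \<oplus> z) \<otimes> (e \<oplus> a) = e \<oplus> (a \<oplus> a \<oplus> z)" using e a z by (simp add: l_distr r_distr a_ac)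
        then show ?thesis using aa z by simp
      qed
      ultimately have "e \<oplus> z = e \<oplus> a" using tripotent[of "e \<oplus> a"] e a by simp
      then have "z = a" using e a z by simp
      then have "z \<otimes> y = z" using act[of z] z by simp
      then show ?thesis using z by (intro piece) (auto simp: constant_on_def)
    next
      case False
      then have e3: "e \<oplus> e \<oplus> e = \<zero>" using insert.prems(3) by (simp add: small_char_def)
      have triple: "b \<oplus> b = \<ominus> b" if "b \<in> carrier R" "e \<otimes> b = b" for b
      proof -
        have "b \<oplus> b \<oplus> b = (e \<oplus> e \<oplus> e) \<otimes> b" using that e by (simp add: l_distr)
        then have "b \<oplus> b \<oplus> b = \<zero>" using e3 that by simp
        then show ?thesis using that by (metis a_closed minus_equality)
      qed
      note aa = triple[OF a(1,2)] and zz = triple[OF z(1,6)]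
      define g where "g = \<ominus> (z \<oplus> a)"
      have gc: "g \<in> carrier R" using a z by (simp add: g_def)
      have g: "g \<otimes> e = g" "g \<otimes> z = g" "g \<otimes> a = g"
        using a e z by (simp_all add: g_def l_distr l_minus z_def[symmetric] a_comm)
      have "g \<otimes> g = \<ominus> (g \<oplus> g)"
        using gc g a z by (subst (2) g_def) (simp add: r_minus r_distr)
      also have "g \<oplus> g = \<ominus> g" using triple[of g] gc g idempotent_central[OF e gc] by simp
      finally have gg: "g \<otimes> g = g" using gc by simp
      have gz: "idem (z \<ominus> g)" "(z \<ominus> g) \<otimes> z = z \<ominus> g" using diff[of z g] z gc gg g by auto
      have "(z \<ominus> g) \<otimes> e = z \<ominus> g" using z gc g e by (simp add: minus_eq l_distr l_minus)
      have "P g"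
      proof (rule piece)
        show "constant_on g y" using act[OF gc g(1)] g by (simp add: constant_on_def)
      qed (use gc gg g in auto)
      moreover have "P (z \<ominus> g)"
      proof (rule piece)
        have "(z \<ominus> g) \<otimes> y = (z \<ominus> g) \<otimes> a" using gz \<open>(z \<ominus> g) \<otimes> e = z \<ominus> g\<close> by (intro act) auto
        also have "\<dots> = a \<oplus> a \<oplus> z" using a z gc g by (simp add: minus_eq l_distr l_minus) (simp add: g_def a_ac)
        also have "\<dots> = \<ominus> a \<ominus> (z \<oplus> z)" using a z unfolding aa zz by (simp add: minus_eq)
        also have "\<dots> = \<ominus> (z \<ominus> g)" using a z by (simp add: g_def minus_eq minus_add a_ac)
        finally show "constant_on (z \<ominus> g) y" by (simp add: constant_on_def)
      qed (use gz \<open>(z \<ominus> g) \<otimes> e = z \<ominus> g\<close> in auto)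
      ultimately show ?thesis using split[of z g] z gc gg g by auto
    qed
    ultimately show ?case using split[of e z] z e by auto
  qed
  \<comment> \<open>Since \<open>6 = 0\<close>, the number 3 is an idempotent that separates characteristic 2 from characteristic 3.\<close>
  define t where "t = \<one> \<oplus> (\<one> \<oplus> \<one>)"
  have t: "idem t" "small_char t" "idem (\<one> \<ominus> t)" "small_char (\<one> \<ominus> t)"
  proof -
    have tc: "t \<in> carrier R" by (simp add: t_def)
    have tt: "t \<oplus> t = \<zero>" using six_eq_zero by (simp add: t_def a_assoc)
    have "t \<otimes> t = t \<oplus> t \<oplus> t" by (simp add: t_def l_distr r_distr a_assoc)
    then show 1: "idem t" using tt tc by simp
    then show "idem (\<one> \<ominus> t)" using idempotent_one_minus[of t] by simp
    show "small_char t" using tt by (simp add: small_char_def)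
    have "(u \<ominus> v) \<oplus> (u \<ominus> v) \<oplus> (u \<ominus> v) = (u \<oplus> (u \<oplus> u)) \<ominus> (v \<oplus> v \<oplus> v)"
      if "u \<in> carrier R" "v \<in> carrier R" for u v
      using that by (simp add: minus_eq minus_add a_ac)
    from this[of \<one> t] show "small_char (\<one> \<ominus> t)"
      using tt tc by (simp add: small_char_def t_def[symmetric] minus_eq r_neg)
  qed
  have "P t" "P (\<one> \<ominus> t)" using small[OF X(1) _ t(1,2)] small[OF X(1) _ t(3,4)] by auto
  then show ?thesis using split[of \<one> t] t by simp
qed


lemma constant_entries_decompose:
  fixes B :: "nat \<Rightarrow> nat \<Rightarrow> 'a"
  assumes e: "idem e" "small_char e"
    and B: "\<And>i j. i < n \<Longrightarrow> j < n \<Longrightarrow> B i j \<in> {\<zero>, e, \<ominus> e}"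
  shows "signed_nil_clean_elem (matrix_ring n R) (mat n n (\<lambda>(i, j). B i j))"
proof (cases "e \<oplus> e = \<zero>")
  case True
  define \<phi> :: "Enum.finite_2 \<Rightarrow> 'a" where "\<phi> c = (if c = 0 then \<zero> else e)" for c
  have "signed_nil_clean_elem (matrix_ring n R)
      (mat n n (\<lambda>(i, j). \<phi> (if B i j = \<zero> then 0 else 1)))"
  proof (rule signed_nil_clean_elem_of_field_matrix)
    show "\<phi> (x + y) = \<phi> x \<oplus> \<phi> y" for x y
      using e True by (cases x; cases y) (simp_all add: \<phi>_def plus_finite_2_def)
    show "\<phi> (x * y) = \<phi> x \<otimes> \<phi> y" for x y
      using e by (cases x; cases y) (simp_all add: \<phi>_def times_finite_2_def)
  qed (use e finite_2_cases in \<open>simp_all add: \<phi>_def\<close>)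
  moreover have "\<ominus> e = e" using minus_equality[OF True] e by simp
  then have "\<phi> (if B i j = \<zero> then 0 else 1) = B i j" if "i < n" "j < n" for i j
    using B[OF that] by (auto simp: \<phi>_def)
  then have "mat n n (\<lambda>(i, j). \<phi> (if B i j = \<zero> then 0 else 1)) = mat n n (\<lambda>(i, j). B i j)"
    by (intro eq_matI) simp_all
  ultimately show ?thesis by simp
next
  case False
  then have e3: "e \<oplus> e \<oplus> e = \<zero>" using e(2) by (simp add: small_char_def)
  have ee: "e \<oplus> e = \<ominus> e" using minus_equality[OF e3] e(1) by simp
  then have mm: "\<ominus> e \<oplus> \<ominus> e = e" using e(1) minus_add[of e e] by simp
  define \<phi> :: "Enum.finite_3 \<Rightarrow> 'a" where "\<phi> c = (if c = 0 then \<zero> else if c = 1 then e else \<ominus> e)" for c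
  have "signed_nil_clean_elem (matrix_ring n R)
      (mat n n (\<lambda>(i, j). \<phi> (if B i j = \<zero> then 0 else if B i j = e then 1 else - 1)))"
  proof (rule signed_nil_clean_elem_of_field_matrix)
    show "\<phi> (x + y) = \<phi> x \<oplus> \<phi> y" for x y
      using e ee mm by (cases x; cases y) (auto simp: \<phi>_def plus_finite_3_def r_neg l_neg)
    show "\<phi> (x * y) = \<phi> x \<otimes> \<phi> y" for x y
      using e by (cases x; cases y) (auto simp: \<phi>_def times_finite_3_def l_minus r_minus)
  qed (use e finite_3_cases finite_3_char in \<open>simp_all add: \<phi>_def\<close>)
  moreover have "\<phi> (if B i j = \<zero> then 0 else if B i j = e then 1 else - 1) = B i j"
    if "i < n" "j < n" for i j
    using B[OF that] by (auto simp: \<phi>_def uminus_finite_3_def)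
  then have "mat n n (\<lambda>(i, j). \<phi> (if B i j = \<zero> then 0 else if B i j = e then 1 else - 1))
      = mat n n (\<lambda>(i, j). B i j)"
    by (intro eq_matI) simp_all
  ultimately show ?thesis by simp
qed

text \<open>
  Splitting along an idempotent \<open>p\<close> of the ring is splitting along the central idempotent scalar matrix of \<open>p\<close>.
\<close>

theorem matrix_signed_nil_clean:
  assumes A: "A \<in> carrier (matrix_ring n R)"
  shows "signed_nil_clean_elem (matrix_ring n R) A"
proof -
  let ?M = "matrix_ring n R"
  interpret M: ring ?M by (rule ring_matrix_ring)
  define scale where "scale e X = mat n n (\<lambda>(i, j). e \<otimes> X $$ (i, j))" for e X
  define diag where "diag e = mat n n (\<lambda>(i, j). if i = j then e else \<zero>)" for e
  have Ac: "A $$ (i, j) \<in> carrier R" if "i < n" "j < n" for i j using A that by (simp add: matrix_ring_def)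
  have diag: "diag e \<in> carrier ?M" if "e \<in> carrier R" for e
    using that by (auto simp: diag_def matrix_ring_def)
  have scale: "scale e X \<in> carrier ?M" if "e \<in> carrier R" "X \<in> carrier ?M" for e X
    using that by (auto simp: scale_def matrix_ring_def)
  have left: "diag e \<otimes>\<^bsub>?M\<^esub> X = scale e X" if e: "e \<in> carrier R" and X: "X \<in> carrier ?M" for e X
  proof (rule eq_matI, goal_cases)
    case (1 i j)
    then have ij: "i < n" "j < n" by (simp_all add: scale_def)
    have Xc: "X $$ (i, j) \<in> carrier R" if "i < n" "j < n" for i j using X that by (simp add: matrix_ring_def)
    have "(diag e \<otimes>\<^bsub>?M\<^esub> X) $$ (i, j) = (\<Oplus>k\<in>{..<n}. if i = k then e \<otimes> X $$ (k, j) else \<zero>)"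
      using ij e Xc by (auto simp: matrix_ring_def diag_def intro!: finsum_cong')
    also have "\<dots> = e \<otimes> X $$ (i, j)" using ij e Xc by (intro finsum_delta) auto
    finally show ?case using ij by (simp add: scale_def)
  qed (auto simp: matrix_ring_def scale_def)
  have right: "X \<otimes>\<^bsub>?M\<^esub> diag e = scale e X" if e: "idem e" and X: "X \<in> carrier ?M" for e X
  proof (rule eq_matI, goal_cases)
    case (1 i j)
    then have ij: "i < n" "j < n" by (simp_all add: scale_def)
    have Xc: "X $$ (i, j) \<in> carrier R" if "i < n" "j < n" for i j using X that by (simp add: matrix_ring_def)
    have "(X \<otimes>\<^bsub>?M\<^esub> diag e) $$ (i, j) = (\<Oplus>k\<in>{..<n}. if j = k then X $$ (i, k) \<otimes> e else \<zero>)"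
      using ij e Xc by (auto simp: matrix_ring_def diag_def intro!: finsum_cong')
    also have "\<dots> = X $$ (i, j) \<otimes> e" using ij e Xc by (intro finsum_delta) auto
    finally show ?case using ij idempotent_central[of e, OF _ _ Xc[OF ij]] e by (simp add: scale_def)
  qed (auto simp: matrix_ring_def scale_def)
  have scale_scale: "scale p (scale e A) = scale (p \<otimes> e) A" if "e \<in> carrier R" "p \<in> carrier R" for e p
    using that Ac by (auto simp: scale_def m_assoc intro!: eq_matI)
  have "signed_nil_clean_elem ?M (scale \<one> A)"
  proof (rule idempotent_split_induct[where X = "mat_entries n A"])
    show "finite (mat_entries n A)" by (rule finite_mat_entries)
    show "mat_entries n A \<subseteq> carrier R" using A by (simp add: carrier_matrix_ring)
    show "signed_nil_clean_elem ?M (scale e A)"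
      if "idem e" "small_char e" "\<And>x. x \<in> mat_entries n A \<Longrightarrow> constant_on e x" for e
      unfolding scale_def
    proof (rule constant_entries_decompose[OF that(1,2)])
      show "e \<otimes> A $$ (i, j) \<in> {\<zero>, e, \<ominus> e}" if "i < n" "j < n" for i j
        using \<open>\<And>x. x \<in> mat_entries n A \<Longrightarrow> constant_on e x\<close> that
        unfolding constant_on_def mat_entries_def by blast
    qed
    show "signed_nil_clean_elem ?M (scale e A)"
      if e: "idem e" and p: "idem p" "p \<otimes> e = p"
        and P: "signed_nil_clean_elem ?M (scale p A)" "signed_nil_clean_elem ?M (scale (e \<ominus> p) A)" for e p
    proof (rule M.signed_nil_clean_elem_split[of "diag p"])
      have eA: "scale e A \<in> carrier ?M" using e A by (simp add: scale)
      show "diag p \<in> carrier ?M" using p by (simp add: diag)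
      show "diag p \<otimes>\<^bsub>?M\<^esub> diag p = diag p"
        using p by (subst left) (auto simp: diag, auto simp: scale_def diag_def intro!: eq_matI)
      show "X \<otimes>\<^bsub>?M\<^esub> diag p = diag p \<otimes>\<^bsub>?M\<^esub> X" if "X \<in> carrier ?M" for X
        using p that by (simp add: left right)
      show "scale e A \<in> carrier ?M" by (rule eA)
      have pA: "diag p \<otimes>\<^bsub>?M\<^esub> scale e A = scale p A"
        using e p eA by (simp add: left scale_scale)
      then show "signed_nil_clean_elem ?M (diag p \<otimes>\<^bsub>?M\<^esub> scale e A)" using P(1) by simp
      have "e = p \<oplus> (e \<ominus> p)" using e p by (simp add: minus_eq a_lcomm[of p e] r_neg)
      then have "scale e A = scale (p \<oplus> (e \<ominus> p)) A" by simp
      also have "\<dots> = scale p A \<oplus>\<^bsub>?M\<^esub> scale (e \<ominus> p) A"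
        using e p Ac by (auto simp: scale_def matrix_ring_def l_distr intro!: eq_matI)
      finally have "scale e A = scale p A \<oplus>\<^bsub>?M\<^esub> scale (e \<ominus> p) A" .
      moreover have c: "scale p A \<in> carrier ?M" "scale (e \<ominus> p) A \<in> carrier ?M" using e p A by (simp_all add: scale)
      ultimately have "scale e A \<ominus>\<^bsub>?M\<^esub> scale p A = scale (e \<ominus> p) A"
        by (simp add: M.minus_eq M.a_comm[of "scale p A"] M.a_assoc M.r_neg)
      moreover have "(\<one>\<^bsub>?M\<^esub> \<ominus>\<^bsub>?M\<^esub> diag p) \<otimes>\<^bsub>?M\<^esub> scale e A = scale e A \<ominus>\<^bsub>?M\<^esub> scale p A"
        using p eA pA by (simp add: M.minus_eq M.l_distr M.l_minus diag)
      ultimately show "signed_nil_clean_elem ?M ((\<one>\<^bsub>?M\<^esub> \<ominus>\<^bsub>?M\<^esub> diag p) \<otimes>\<^bsub>?M\<^esub> scale e A)"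
        using P(2) by simp
    qed
  qed
  moreover have "scale \<one> A = A" using A by (auto simp: scale_def matrix_ring_def intro!: eq_matI)
  ultimately show ?thesis by simp
qed

end

section \<open>Two-primal strongly 2-nil-clean rings\<close>

text \<open>
  Modulo nilpotents every element is a sum \<open>e + f\<close> of commuting idempotents, and \<open>(e + f)\<^sup>3 = e + f + 6 e f\<close>.
  For \<open>3 = e + f\<close>, multiplying by \<open>e f\<close> gives \<open>3 e f = 2 e f\<close>, so \<open>e f = 0\<close>; multiplying by \<open>e\<close> and by \<open>f\<close>
  then gives \<open>2 e = 0\<close> and \<open>2 f = 0\<close>, hence \<open>6 = 0\<close>.
\<close>

lemma strongly_2_nil_clean_quotient_tripotent:
  assumes h: "ring_hom_ring R S h" and surj: "h ` carrier R = carrier S"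
    and nil: "\<And>x. nilpotent_elem R x \<Longrightarrow> h x = \<zero>\<^bsub>S\<^esub>"
    and R: "strongly_2_nil_clean R"
  shows "tripotent_ring S"
proof -
  interpret h: ring_hom_ring R S h by (rule h)
  have sum: "\<exists>e f. e \<in> carrier S \<and> f \<in> carrier S \<and> e \<otimes>\<^bsub>S\<^esub> e = e \<and> f \<otimes>\<^bsub>S\<^esub> f = f \<and>
      e \<otimes>\<^bsub>S\<^esub> f = f \<otimes>\<^bsub>S\<^esub> e \<and> x = e \<oplus>\<^bsub>S\<^esub> f" if "x \<in> carrier S" for x
  proof -
    have "x \<in> h ` carrier R" using that surj by simp
    then obtain a where a: "a \<in> carrier R" "x = h a" by (rule imageE)
    obtain e f b where *: "idempotent_elem R e" "idempotent_elem R f" "nilpotent_elem R b"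
      "e \<otimes>\<^bsub>R\<^esub> f = f \<otimes>\<^bsub>R\<^esub> e" "a = e \<oplus>\<^bsub>R\<^esub> f \<oplus>\<^bsub>R\<^esub> b"
      using R[unfolded strongly_2_nil_clean_def, rule_format, OF a(1)]
      by (elim exE conjE) (rule that; assumption)
    then have c: "e \<in> carrier R" "f \<in> carrier R" "b \<in> carrier R"
      by (auto simp: idempotent_elem_def nilpotent_elem_def)
    have "h e \<otimes>\<^bsub>S\<^esub> h e = h e" "h f \<otimes>\<^bsub>S\<^esub> h f = h f" "h e \<otimes>\<^bsub>S\<^esub> h f = h f \<otimes>\<^bsub>S\<^esub> h e"
      using * c by (simp_all add: h.hom_mult[symmetric] idempotent_elem_def del: h.hom_mult)
    moreover have "x = h e \<oplus>\<^bsub>S\<^esub> h f"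
      unfolding a(2) *(5) using c nil[OF *(3)] by simp
    ultimately show ?thesis using c by (intro exI[of _ "h e"] exI[of _ "h f"]) simp
  qed
  note S_simps = h.S.l_distr h.S.r_distr h.S.a_ac
  have cube: "x \<otimes>\<^bsub>S\<^esub> x \<otimes>\<^bsub>S\<^esub> x = x \<oplus>\<^bsub>S\<^esub> (p \<oplus>\<^bsub>S\<^esub> (p \<oplus>\<^bsub>S\<^esub> (p \<oplus>\<^bsub>S\<^esub> (p \<oplus>\<^bsub>S\<^esub> (p \<oplus>\<^bsub>S\<^esub> p)))))"
    if c: "e \<in> carrier S" "f \<in> carrier S" and i: "e \<otimes>\<^bsub>S\<^esub> e = e" "f \<otimes>\<^bsub>S\<^esub> f = f"
      and ef: "e \<otimes>\<^bsub>S\<^esub> f = p" "f \<otimes>\<^bsub>S\<^esub> e = p" and x: "x = e \<oplus>\<^bsub>S\<^esub> f" for e f p x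
  proof -
    have p: "p \<in> carrier S" using c ef by auto
    have pe: "p \<otimes>\<^bsub>S\<^esub> e = p" "p \<otimes>\<^bsub>S\<^esub> f = p"
      using h.S.m_assoc[OF c(2,1,1)] h.S.m_assoc[OF c(1,2,2)] i ef by simp_all
    have "x \<otimes>\<^bsub>S\<^esub> x = e \<oplus>\<^bsub>S\<^esub> f \<oplus>\<^bsub>S\<^esub> p \<oplus>\<^bsub>S\<^esub> p" using c p i ef by (simp add: x S_simps)
    then show ?thesis using c p i ef pe by (simp add: x S_simps)
  qed
  let ?n = "\<one>\<^bsub>S\<^esub> \<oplus>\<^bsub>S\<^esub> (\<one>\<^bsub>S\<^esub> \<oplus>\<^bsub>S\<^esub> \<one>\<^bsub>S\<^esub>)"
  have six: "?n \<oplus>\<^bsub>S\<^esub> ?n = \<zero>\<^bsub>S\<^esub>"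
  proof -
    obtain e f where c: "e \<in> carrier S" "f \<in> carrier S" and i: "e \<otimes>\<^bsub>S\<^esub> e = e" "f \<otimes>\<^bsub>S\<^esub> f = f"
      and ef: "e \<otimes>\<^bsub>S\<^esub> f = f \<otimes>\<^bsub>S\<^esub> e" and n: "?n = e \<oplus>\<^bsub>S\<^esub> f"
      using sum[of ?n] by auto
    define p where "p = e \<otimes>\<^bsub>S\<^esub> f"
    have p: "p \<in> carrier S" using c by (simp add: p_def)
    have triple: "x \<oplus>\<^bsub>S\<^esub> (x \<oplus>\<^bsub>S\<^esub> x) = x \<otimes>\<^bsub>S\<^esub> e \<oplus>\<^bsub>S\<^esub> x \<otimes>\<^bsub>S\<^esub> f" if "x \<in> carrier S" for x
    proof -
      have "x \<oplus>\<^bsub>S\<^esub> (x \<oplus>\<^bsub>S\<^esub> x) = x \<otimes>\<^bsub>S\<^esub> ?n" using that by (simp add: h.S.r_distr)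
      then show ?thesis unfolding n using that c by (simp add: h.S.r_distr)
    qed
    have pe: "p \<otimes>\<^bsub>S\<^esub> e = p" "p \<otimes>\<^bsub>S\<^esub> f = p"
    proof -
      show "p \<otimes>\<^bsub>S\<^esub> f = p" using c i by (simp add: p_def h.S.m_assoc)
      show "p \<otimes>\<^bsub>S\<^esub> e = p" using c i unfolding p_def ef by (simp add: h.S.m_assoc)
    qed
    have "p \<oplus>\<^bsub>S\<^esub> p \<oplus>\<^bsub>S\<^esub> p = p \<oplus>\<^bsub>S\<^esub> p \<oplus>\<^bsub>S\<^esub> \<zero>\<^bsub>S\<^esub>"
      using triple[OF p] p pe by (simp add: h.S.a_assoc)
    then have p0: "p = \<zero>\<^bsub>S\<^esub>" using p by (simp only: h.S.add.l_cancel h.S.a_closed h.S.zero_closed)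
    have double: "x \<oplus>\<^bsub>S\<^esub> x = \<zero>\<^bsub>S\<^esub>" if "x \<in> carrier S" "x \<oplus>\<^bsub>S\<^esub> (x \<oplus>\<^bsub>S\<^esub> x) = x" for x
    proof -
      have "x \<oplus>\<^bsub>S\<^esub> (x \<oplus>\<^bsub>S\<^esub> x) = x \<oplus>\<^bsub>S\<^esub> \<zero>\<^bsub>S\<^esub>" using that by simp
      then show ?thesis using that(1) by (simp only: h.S.add.l_cancel h.S.a_closed h.S.zero_closed)
    qed
    have ef0: "e \<otimes>\<^bsub>S\<^esub> f = \<zero>\<^bsub>S\<^esub>" "f \<otimes>\<^bsub>S\<^esub> e = \<zero>\<^bsub>S\<^esub>" using p0 ef by (simp_all add: p_def)
    have "e \<oplus>\<^bsub>S\<^esub> e = \<zero>\<^bsub>S\<^esub>"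
      using triple[OF c(1)] c by (intro double) (simp_all add: i ef0)
    moreover have "f \<oplus>\<^bsub>S\<^esub> f = \<zero>\<^bsub>S\<^esub>"
      using triple[OF c(2)] c by (intro double) (simp_all add: i ef0)
    moreover have "?n \<oplus>\<^bsub>S\<^esub> ?n = (e \<oplus>\<^bsub>S\<^esub> e) \<oplus>\<^bsub>S\<^esub> (f \<oplus>\<^bsub>S\<^esub> f)"
      unfolding n using c by (simp add: h.S.a_ac)
    ultimately show ?thesis by simp
  qed
  show ?thesis
  proof (intro tripotent_ring.intro tripotent_ring_axioms.intro)
    show "ring S" by (rule h.S.ring_axioms)
    fix x assume xc: "x \<in> carrier S"
    obtain e f where c: "e \<in> carrier S" "f \<in> carrier S" and i: "e \<otimes>\<^bsub>S\<^esub> e = e" "f \<otimes>\<^bsub>S\<^esub> f = f"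
      and ef: "e \<otimes>\<^bsub>S\<^esub> f = f \<otimes>\<^bsub>S\<^esub> e" and x: "x = e \<oplus>\<^bsub>S\<^esub> f"
      using sum[OF xc] by auto
    define p where "p = e \<otimes>\<^bsub>S\<^esub> f"
    have p: "p \<in> carrier S" using c by (simp add: p_def)
    have "p \<oplus>\<^bsub>S\<^esub> (p \<oplus>\<^bsub>S\<^esub> (p \<oplus>\<^bsub>S\<^esub> (p \<oplus>\<^bsub>S\<^esub> (p \<oplus>\<^bsub>S\<^esub> p)))) = (?n \<oplus>\<^bsub>S\<^esub> ?n) \<otimes>\<^bsub>S\<^esub> p"
      using p by (simp add: h.S.l_distr h.S.a_assoc)
    also have "\<dots> = \<zero>\<^bsub>S\<^esub>" unfolding six using p by simp
    finally have six_p: "p \<oplus>\<^bsub>S\<^esub> (p \<oplus>\<^bsub>S\<^esub> (p \<oplus>\<^bsub>S\<^esub> (p \<oplus>\<^bsub>S\<^esub> (p \<oplus>\<^bsub>S\<^esub> p)))) = \<zero>\<^bsub>S\<^esub>" .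
    have fe: "f \<otimes>\<^bsub>S\<^esub> e = p" by (simp add: p_def ef)
    show "x \<otimes>\<^bsub>S\<^esub> x \<otimes>\<^bsub>S\<^esub> x = x"
      using cube[OF c i p_def[symmetric] fe x] xc unfolding six_p by simp
  qed
qed

theorem theorem4p4:
  fixes R :: "('a, 'm) ring_scheme"
  assumes "ring R"
    and "two_primal R"
    and "strongly_2_nil_clean R"
  shows "\<forall>n::nat. n \<ge> 1 \<longrightarrow> trinil_clean (matrix_ring n R)"
proof (intro allI impI)
  fix n :: nat
  interpret ring R by (rule assms(1))
  let ?M = "matrix_ring n R"
  define N where "N = prime_radical R"
  interpret N: ideal N R unfolding N_def by (rule prime_radical_ideal)
  let ?S = "R Quot N" and ?\<pi> = "(+>\<^bsub>R\<^esub>) N"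
  let ?h = "\<lambda>A. mat n n (\<lambda>(i, j). ?\<pi> (A $$ (i, j)))"
  have N_eq: "N = {a. nilpotent_elem R a}" using assms(2) by (simp add: N_def two_primal_def)
  have \<pi>: "ring_hom_ring R ?S ?\<pi>" by (rule N.rcos_ring_hom_ring)
  have kernel: "x \<in> N" if "x \<in> carrier R" "?\<pi> x = \<zero>\<^bsub>?S\<^esub>" for x
    using N.rcos_const_imp_mem[OF that(1)] that(2) by (simp add: FactRing_def)
  have surj: "?\<pi> ` carrier R = carrier ?S" by (auto simp: FactRing_def A_RCOSETS_def')
  have "tripotent_ring ?S"
    using \<pi> surj
  proof (rule strongly_2_nil_clean_quotient_tripotent)
    show "?\<pi> x = \<zero>\<^bsub>?S\<^esub>" if "nilpotent_elem R x" for x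
      using that N.a_rcos_const[of x] by (simp add: FactRing_def N_eq)
  qed (rule assms(3))
  then interpret S: tripotent_ring ?S .
  interpret M: ring ?M by (rule ring_matrix_ring)
  interpret h: ring_hom_ring ?M "matrix_ring n ?S" ?h by (rule matrix_ring_hom[OF \<pi>])
  have "signed_nil_clean_elem ?M A" if A: "A \<in> carrier ?M" for A
  proof (rule h.signed_nil_clean_elem_lifts[OF _ _ A])
    show "nilpotent_elem ?M X" if X: "X \<in> carrier ?M" "?h X = \<zero>\<^bsub>matrix_ring n ?S\<^esub>" for X
    proof (rule matrix_over_prime_radical_nilpotent[OF X(1)])
      have "X $$ (i, j) \<in> N" if "i < n" "j < n" for i j
      proof (rule kernel)
        have "?h X $$ (i, j) = \<zero>\<^bsub>?S\<^esub>" using that by (simp add: X(2)) (simp add: matrix_ring_def)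
        then show "?\<pi> (X $$ (i, j)) = \<zero>\<^bsub>?S\<^esub>" using that by simp
      qed (use X(1) that in \<open>simp add: matrix_ring_def\<close>)
      then show "mat_entries n X \<subseteq> prime_radical R" by (simp add: mat_entries_subset_iff N_def)
    qed
    show "?h ` carrier ?M = carrier (matrix_ring n ?S)"
    proof
      show "carrier (matrix_ring n ?S) \<subseteq> ?h ` carrier ?M"
      proof
        fix Y assume Y: "Y \<in> carrier (matrix_ring n ?S)"
        define r where "r = inv_into (carrier R) ?\<pi>"
        have r: "r y \<in> carrier R \<and> ?\<pi> (r y) = y" if "y \<in> carrier ?S" for y
          using that unfolding surj[symmetric] r_def by (simp only: inv_into_into f_inv_into_f simp_thms)
        have "Y = ?h (mat n n (\<lambda>(i, j). r (Y $$ (i, j))))"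
          using Y r by (auto simp: matrix_ring_def intro!: eq_matI)
        moreover have "mat n n (\<lambda>(i, j). r (Y $$ (i, j))) \<in> carrier ?M"
          using Y r by (auto simp: matrix_ring_def)
        ultimately show "Y \<in> ?h ` carrier ?M" by (rule image_eqI)
      qed
      show "?h ` carrier ?M \<subseteq> carrier (matrix_ring n ?S)"
        using h.hom_closed by (rule image_subsetI)
    qed
    show "signed_nil_clean_elem (matrix_ring n ?S) (?h A)"
      using A by (intro S.matrix_signed_nil_clean h.hom_closed)
  qed
  then show "trinil_clean ?M"
    unfolding trinil_clean_def using M.signed_nil_clean_imp_tripotent_plus_nilpotent by blast
qed

end
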